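(* For $\alpha>0$, $\beta>0$ let $$f(t)=\frac{1}{B(\alpha,\beta)}(1-t)^{\alpha-1}t^{\beta-1}\quad(0<t<1),$$ where $B(\alpha,\beta)$ is the beta function, and for $x>0$ let $$\Phi(x)=\int_0^1 f(t)\cos xt\,dt,\qquad \Psi(x)=\int_0^1 f(t)\sin xt\,dt.$$ Define subsets $\mathcal{P}_c^*\subset\mathcal{P}_s^*$ of $\{(\alpha,\beta):\alpha>0,\ \beta>0\}$ by \begin{align*} \mathcal{P}_c^* &= \left\{(\alpha,\beta): 0<\alpha\le 1,\ \beta\ge\max\left(\tfrac53,\ \alpha+1\right),\ (\alpha,\beta)\ne(1,2)\right\}\\ &\qquad\cup\left\{(\alpha,\beta): 0<\alpha\le\tfrac23,\ 1\le\beta\le\tfrac53\right\},\\ \mathcal{P}_s^* &= \left\{(\alpha,\beta): 0<\alpha\le 2,\ \beta\ge\max\left(\tfrac12,\ \tfrac{\alpha+1}{2},\ 2\alpha-1\right)\ \text{and}\ (\alpha,\beta)\ne(1,1)\right\}. \end{align*} (i) If $(\alpha,\beta)\in\mathcal{P}_c^*$, then for each $k=1,2,\dots$, $\Phi$ has exactly one zero in the interval $\big((k-1/2)\pi,\,k\pi\big)$, and this zero is simple, and $\Psi$ has exactly one zero in the interval $\big(k\pi,\,(k+1/2)\pi\big)$, and this zero is simple. Moreover, $\Phi$ and $\Psi$ have no positive zeros elsewhere and share no common positive zeros. (ii) If $(\alpha,\beta)\in\mathcal{P}_s^*\setminus\mathcal{P}_c^*$, then for each $k=1,2,\dots$, $\Phi$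 has exactly one zero in the interval $\big((k-1/2)\pi,\,(k+1/2)\pi\big)$, and this zero is simple, and $\Psi$ has exactly one zero in the interval $\big(k\pi,\,(k+1)\pi\big)$, and this zero is simple. Moreover, $\Phi$ and $\Psi$ have no positive zeros elsewhere and share no common positive zeros. *)

theory Defs
  imports "HOL-Analysis.Analysis"
begin

definition beta_density :: "real \<Rightarrow> real \<Rightarrow> real \<Rightarrow> real" where
  "beta_density \<alpha> \<beta> t = 1 / Beta \<alpha> \<beta> * (1 - t) powr (\<alpha> - 1) * t powr (\<beta> - 1)"

definition Phi :: "real \<Rightarrow> real \<Rightarrow> real \<Rightarrow> real" where
  "Phi \<alpha> \<beta> x = integral {0<..<1} (\<lambda>t. beta_density \<alpha> \<beta> t * cos (x * t))"

definition Psi :: "real \<Rightarrow> real \<Rightarrow> real \<Rightarrow> real" where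
  "Psi \<alpha> \<beta> x = integral {0<..<1} (\<lambda>t. beta_density \<alpha> \<beta> t * sin (x * t))"

definition P_c :: "(real \<times> real) set" where
  "P_c = {(\<alpha>, \<beta>). 0 < \<alpha> \<and> \<alpha> \<le> 1 \<and> \<beta> \<ge> max (5/3) (\<alpha> + 1) \<and> (\<alpha>, \<beta>) \<noteq> (1, 2)}
       \<union> {(\<alpha>, \<beta>). 0 < \<alpha> \<and> \<alpha> \<le> 2/3 \<and> 1 \<le> \<beta> \<and> \<beta> \<le> 5/3}"

definition P_s :: "(real \<times> real) set" where
  "P_s = {(\<alpha>, \<beta>). 0 < \<alpha> \<and> \<alpha> \<le> 2 \<and> \<beta> \<ge> max (1/2) (max ((\<alpha> + 1) / 2) (2 * \<alpha> - 1))
                 \<and> (\<alpha>, \<beta>) \<noteq> (1, 1)}"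

text \<open>Existence of the derivative is part of the definition; \<open>deriv g x \<noteq> 0\<close> alone would not
  guarantee it.\<close>

definition simple_zero :: "(real \<Rightarrow> real) \<Rightarrow> real \<Rightarrow> bool" where
  "simple_zero g x \<longleftrightarrow> g x = 0 \<and> (\<exists>D. (g has_real_derivative D) (at x) \<and> D \<noteq> 0)"

definition one_zero_simple :: "(real \<Rightarrow> real) \<Rightarrow> real set \<Rightarrow> bool" where
  "one_zero_simple g S \<longleftrightarrow> (\<exists>!x. x \<in> S \<and> g x = 0) \<and> (\<forall>x\<in>S. g x = 0 \<longrightarrow> simple_zero g x)"

end

theory Submission
  imports
    Defs
    "HOL-Complex_Analysis.Complex_Analysis"
    "HOL-Real_Asymp.Real_Asymp"
begin

text \<open>
  Let \<open>K a b x\<close> be the integral of \<open>t^(a-1) (1-t)^(b-1) e^(ixt)\<close> over \<open>[0,1]\<close>. Up to the factor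
  \<open>1 / B(\<alpha>,\<beta>)\<close>, \<open>\<Phi> + i\<Psi>\<close> is \<open>F = K \<beta> \<alpha>\<close>, and reflecting \<open>t\<close> to \<open>1 - t\<close> gives
  \<open>F x = e^(ix) * cnj (U x + i V x)\<close> with \<open>U + iV = K \<alpha> \<beta>\<close>.

  If \<open>V > 0\<close>, then \<open>\<Phi>\<close> and \<open>\<Psi>\<close> change sign between the stated points and at each zero of one of them the
  sign of the other is known. Kummer's equation for \<open>F\<close> shows that \<open>x^(\<alpha>+\<beta>) (W - |F|^2 / 2)\<close> has derivative
  \<open>(\<beta>-\<alpha>)/2 * x^(\<alpha>+\<beta>-1) |F|^2\<close>, where \<open>W = \<Phi> \<Psi>' - \<Psi> \<Phi>'\<close>; since \<open>\<beta> \<ge> \<alpha>\<close>, \<open>W > 0\<close>. Hence all zeros in one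
  of the intervals are crossed in the same direction, so there is exactly one and it is simple. If also
  \<open>U > 0\<close>, the sign change happens in the left half of the interval.

  For the positivity of \<open>V\<close> and \<open>U\<close>, fractional integration raises \<open>\<beta>\<close>, so only the lower boundary of the
  regions matters. There the path \<open>[0,1]\<close> is deformed into the two vertical rays starting at \<open>0\<close> and \<open>1\<close>;
  the ray at \<open>0\<close> carries the main term, the ray at \<open>1\<close> is bounded in absolute value, and
  the two are compared by elementary inequalities. Small \<open>x\<close> are treated directly.
\<close>

section \<open>The Fourier transform of the beta weight\<close>

text \<open>On the segment the oscillation hides the signs of \<open>U\<close> and \<open>V\<close>.
  On a vertical ray the exponential decays without oscillating along the ray, and the phase of the
  integrand is an explicit angle. The ray at 1 carries the extra factor e^(ix), whose direction
  turns with x, so only its modulus is of use. The corners of the regions shape the estimates. At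
  (1,1) one has V = (1 - cos x)/x, and at (1,2) one has U = (1 - cos x)/x^2; both vanish at the
  multiples of 2 pi, which is why these points are excluded. Near (1,1) the two rays almost cancel,
  so on the boundary lines of \<open>P_s\<close> through it, parametrized as (1 - 2h, 1 - h) and (1
  + h, 1 + 2h), the comparison has to keep the terms of first order in h. Fractional integration can
  nevertheless start from the corners, because it asks of the boundary only a weak inequality,
  together with strict positivity for small x.\<close>

lemma has_bochner_integral_lborel_nonneg:
  fixes f :: "real \<Rightarrow> real"
  assumes "f \<in> borel_measurable borel" "\<And>x. 0 \<le> f x" "(f has_integral I) UNIV"
  shows "has_bochner_integral lborel f I"
  using assms has_integral_nonneg[OF assms(3)]
  by (intro has_bochner_integral_nn_integral nn_integral_has_integral_lborel) auto

lemma integral_lborel_pos: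
  fixes f :: "real \<Rightarrow> real"
  assumes f: "integrable lborel f" and nn: "\<And>t. 0 \<le> f t"
    and pos: "\<And>t. c < t \<Longrightarrow> t < d \<Longrightarrow> 0 < f t" and cd: "c < d"
  shows "0 < integral\<^sup>L lborel f"
proof (rule ccontr)
  assume "\<not> ?thesis"
  with Bochner_Integration.integral_nonneg[of lborel f] nn have "integral\<^sup>L lborel f = 0"
    by (simp add: order_antisym)
  then have "AE t in lborel. f t = 0"
    using integral_nonneg_eq_0_iff_AE[OF f] nn by simp
  then have "AE t in lborel. t \<notin> {c<..<d}"
    by eventually_elim (use pos in force)
  then have "emeasure lborel {c<..<d} = 0"
    by (subst (asm) AE_iff_measurable[OF _ refl]) (auto simp: Collect_conj_eq[symmetric] greaterThanLessThan_def greaterThan_def lessThan_def Int_def)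
  with cd show False by simp
qed

text \<open>The first parameter is the exponent at 0, so that multiplication by a power of
  \<open>t\<close> only shifts it; the density of the theorem is therefore the weight with
  parameters \<beta>, \<alpha> in this order. The value 0 outside the open interval lets every
  integral run over the whole line.\<close>

definition beta_weight :: "real \<Rightarrow> real \<Rightarrow> real \<Rightarrow> real" where
  "beta_weight a b t = (if 0 < t \<and> t < 1 then t powr (a - 1) * (1 - t) powr (b - 1) else 0)"

definition beta_fourier :: "real \<Rightarrow> real \<Rightarrow> real \<Rightarrow> complex" where
  "beta_fourier a b x = (LINT t|lborel. beta_weight a b t *\<^sub>R cis (x * t))"

lemma beta_weight_measurable [measurable]: "beta_weight a b \<in> borel_measurable borel"
  unfolding beta_weight_def [abs_def] by measurable

lemma beta_weight_nonneg [simp]: "0 \<le> beta_weight a b t"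
  by (simp add: beta_weight_def)

lemma beta_weight_pos: "0 < t \<Longrightarrow> t < 1 \<Longrightarrow> 0 < beta_weight a b t"
  by (simp add: beta_weight_def)

lemma beta_weight_eq_0: "\<not> (0 < t \<and> t < 1) \<Longrightarrow> beta_weight a b t = 0"
  by (auto simp: beta_weight_def)

lemma beta_weight_shift:
  "t powr c * beta_weight a b t = beta_weight (a + c) b t"
  by (simp add: beta_weight_def powr_add[symmetric] algebra_simps)

lemma beta_weight_shift_power:
  "t ^ n * beta_weight a b t = beta_weight (a + real n) b t"
  using beta_weight_shift[of t "real n" a b]
  by (cases "t > 0") (simp_all add: powr_realpow beta_weight_eq_0)

lemma beta_weight_reflect: "beta_weight a b (1 - t) = beta_weight b a t"
  by (auto simp: beta_weight_def mult.commute)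

lemma has_bochner_integral_beta_weight:
  assumes "a > 0" "b > 0"
  shows "has_bochner_integral lborel (beta_weight a b) (Beta a b)"
proof (rule has_bochner_integral_lborel_nonneg)
  have "((\<lambda>t. if t \<in> {0..1} then t powr (a - 1) * (1 - t) powr (b - 1) else 0) has_integral Beta a b) UNIV"
    using has_integral_Beta_real[OF assms] by (subst has_integral_restrict_UNIV)
  then show "(beta_weight a b has_integral Beta a b) UNIV"
    by (rule has_integral_spike_finite[of "{0,1}", rotated 2]) (auto simp: beta_weight_def)
qed (auto simp: beta_weight_measurable)

lemma integrable_beta_weight: "a > 0 \<Longrightarrow> b > 0 \<Longrightarrow> integrable lborel (beta_weight a b)"
  using has_bochner_integral_beta_weight by (auto simp: has_bochner_integral_iff)

lemma integral_beta_weight: "a > 0 \<Longrightarrow> b > 0 \<Longrightarrow> integral\<^sup>L lborel (beta_weight a b) = Beta a b"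
  using has_bochner_integral_beta_weight by (auto simp: has_bochner_integral_iff)

lemma integrable_beta_weight_scaleR:
  fixes h :: "real \<Rightarrow> 'a::{banach,second_countable_topology}"
  assumes "a > 0" "b > 0" and h [measurable]: "h \<in> borel_measurable borel"
    and bd: "\<And>t. 0 < t \<Longrightarrow> t < 1 \<Longrightarrow> norm (h t) \<le> C"
  shows "integrable lborel (\<lambda>t. beta_weight a b t *\<^sub>R h t)"
proof (rule Bochner_Integration.integrable_bound)
  show "integrable lborel (\<lambda>t. beta_weight a b t * C)"
    using integrable_beta_weight[OF assms(1,2)] by simp
  have "norm (beta_weight a b t *\<^sub>R h t) \<le> norm (beta_weight a b t * C)" for t
  proof (cases "0 < t \<and> t < 1")
    case True
    then show ?thesis using bd[of t] norm_ge_zero[of "h t"]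
      by (simp add: abs_mult) (intro mult_left_mono, auto)
  qed (simp add: beta_weight_eq_0)
  then show "AE t in lborel. norm (beta_weight a b t *\<^sub>R h t) \<le> norm (beta_weight a b t * C)"
    by simp
qed measurable

lemma cis_measurable [measurable]: "cis \<in> borel_measurable borel"
  by (intro borel_measurable_continuous_onI continuous_on_cis continuous_on_id)

lemma integrable_beta_fourier:
  assumes "a > 0" "b > 0"
  shows "integrable lborel (\<lambda>t. beta_weight a b t *\<^sub>R cis (x * t))"
  by (rule integrable_beta_weight_scaleR[where C = 1]) (use assms in auto)

lemma beta_fourier_reflect:
  assumes "a > 0" "b > 0"
  shows "beta_fourier b a x = cis x * cnj (beta_fourier a b x)"
proof -
  have "beta_fourier b a x = (LINT t|lborel. beta_weight b a (1 - t) *\<^sub>R cis (x * (1 - t)))"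
    unfolding beta_fourier_def by (subst lborel_integral_real_affine[of "-1" _ 1]) auto
  also have "\<dots> = (LINT t|lborel. cis x * cnj (beta_weight a b t *\<^sub>R cis (x * t)))"
    by (intro Bochner_Integration.integral_cong)
       (auto simp: beta_weight_reflect cis_cnj cis_mult algebra_simps)
  also have "\<dots> = cis x * cnj (beta_fourier a b x)"
    using integrable_beta_fourier[OF assms, of x]
    by (simp add: beta_fourier_def del: complex_cnj_scaleR)
  finally show ?thesis .
qed

lemma Re_beta_fourier:
  assumes "a > 0" "b > 0"
  shows "Re (beta_fourier a b x) = (LINT t|lborel. beta_weight a b t * cos (x * t))"
  using integral_Re[OF integrable_beta_fourier[OF assms, of x]] by (simp add: beta_fourier_def)

lemma Im_beta_fourier:
  assumes "a > 0" "b > 0"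
  shows "Im (beta_fourier a b x) = (LINT t|lborel. beta_weight a b t * sin (x * t))"
  using integral_Im[OF integrable_beta_fourier[OF assms, of x]] by (simp add: beta_fourier_def)

text \<open>Strict positivity is asked only near 0, because in the fractional integrals below the
  integrand may vanish at larger arguments.\<close>

lemma integral_beta_weight_pos:
  assumes "a > 0" "b > 0" and h [measurable]: "h \<in> borel_measurable borel"
    and bd: "\<And>t. 0 < t \<Longrightarrow> t < 1 \<Longrightarrow> \<bar>h t\<bar> \<le> C"
    and nn: "\<And>t. 0 < t \<Longrightarrow> t < 1 \<Longrightarrow> 0 \<le> h t"
    and pos: "\<And>t. 0 < t \<Longrightarrow> t < d \<Longrightarrow> 0 < h t" "0 < d"
  shows "0 < (LINT t|lborel. beta_weight a b t * h t)"
proof (rule integral_lborel_pos)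
  show "integrable lborel (\<lambda>t. beta_weight a b t * h t)"
    using integrable_beta_weight_scaleR[OF assms(1-3), of C] bd by simp
  show "0 \<le> beta_weight a b t * h t" for t
    using nn[of t] by (cases "0 < t \<and> t < 1") (auto simp: beta_weight_eq_0)
  show "0 < beta_weight a b t * h t" if "0 < t" "t < min d 1" for t
    using that pos by (auto simp: beta_weight_pos)
qed (use pos in auto)

lemma Im_beta_fourier_pos_le_pi:
  assumes "a > 0" "b > 0" "0 < x" "x \<le> pi"
  shows "0 < Im (beta_fourier a b x)"
proof -
  have "0 < sin (x * t)" if "0 < t" "t < 1" for t
  proof -
    have "x * t < pi" by (rule less_le_trans[of _ x]) (use that assms in auto)
    then show ?thesis using that assms by (intro sin_gt_zero) auto
  qed
  then show ?thesis unfolding Im_beta_fourier[OF assms(1,2)]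
    by (intro integral_beta_weight_pos[where C = 1 and d = 1]) (use assms in \<open>auto intro: less_imp_le\<close>)
qed

lemma Re_beta_fourier_pos_le_half_pi:
  assumes "a > 0" "b > 0" "0 < x" "x \<le> pi/2"
  shows "0 < Re (beta_fourier a b x)"
proof -
  have "0 < cos (x * t)" if "0 < t" "t < 1" for t
  proof -
    have "x * t < pi/2" by (rule less_le_trans[of _ x]) (use that assms in auto)
    then show ?thesis using that assms by (intro cos_gt_zero) auto
  qed
  then show ?thesis unfolding Re_beta_fourier[OF assms(1,2)]
    by (intro integral_beta_weight_pos[where C = 1 and d = 1]) (use assms in \<open>auto intro: less_imp_le\<close>)
qed

lemma Phi_Psi_eq:
  assumes "\<alpha> > 0" "\<beta> > 0"
  shows "Phi \<alpha> \<beta> x = Re (beta_fourier \<beta> \<alpha> x) / Beta \<alpha> \<beta>"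
    and "Psi \<alpha> \<beta> x = Im (beta_fourier \<beta> \<alpha> x) / Beta \<alpha> \<beta>"
proof -
  have *: "integral {0<..<1} (\<lambda>t. beta_density \<alpha> \<beta> t * h t) = (LINT t|lborel. beta_weight \<beta> \<alpha> t * h t) / Beta \<alpha> \<beta>"
    if [measurable]: "h \<in> borel_measurable borel" and bd: "\<And>t. \<bar>h t\<bar> \<le> 1" for h :: "real \<Rightarrow> real"
  proof -
    have i: "integrable lborel (\<lambda>t. beta_weight \<beta> \<alpha> t * h t)"
      using integrable_beta_weight_scaleR[OF assms(2,1), of h 1] bd by auto
    have "integral {0<..<1} (\<lambda>t. beta_density \<alpha> \<beta> t * h t) =
      integral UNIV (\<lambda>t. if t \<in> {0<..<1} then beta_density \<alpha> \<beta> t * h t else 0)"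
      by (subst integral_restrict_UNIV) simp
    also have "\<dots> = integral UNIV (\<lambda>t. beta_weight \<beta> \<alpha> t * h t / Beta \<alpha> \<beta>)"
      by (rule arg_cong[where f = "integral UNIV"]) (auto simp: beta_weight_def beta_density_def)
    also have "\<dots> = (LINT t|lborel. beta_weight \<beta> \<alpha> t * h t) / Beta \<alpha> \<beta>"
      using integral_lborel[of "\<lambda>t. beta_weight \<beta> \<alpha> t * h t / Beta \<alpha> \<beta>"] i by simp
    finally show ?thesis .
  qed
  show "Phi \<alpha> \<beta> x = Re (beta_fourier \<beta> \<alpha> x) / Beta \<alpha> \<beta>"
    unfolding Phi_def Re_beta_fourier[OF assms(2,1)] by (rule *) auto
  show "Psi \<alpha> \<beta> x = Im (beta_fourier \<beta> \<alpha> x) / Beta \<alpha> \<beta>"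
    unfolding Psi_def Im_beta_fourier[OF assms(2,1)] by (rule *) auto
qed

lemma Beta_real_pos: "a > 0 \<Longrightarrow> b > 0 \<Longrightarrow> 0 < (Beta a b :: real)"
  by (simp add: Beta_def Gamma_real_pos)

text \<open>Differentiation under the integral sign: the first-order Taylor remainder of
  \<open>cis (y * t)\<close> around x is at most (y - x)^2 for all t in (0,1), which leaves an error
  of |y - x| times a Beta value in the difference quotient.\<close>

lemma has_vector_derivative_beta_fourier:
  assumes "a > 0" "b > 0"
  shows "(beta_fourier a b has_vector_derivative \<i> * beta_fourier (a + 1) b x) (at x)"
  unfolding has_vector_derivative_def
proof (rule has_derivativeI_sandwich[where e = 1])
  have est: "norm (cis (y * t) - cis (x * t) - (y - x) *\<^sub>R (\<i> * t * cis (x * t))) \<le> (y - x)\<^sup>2"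
    if "0 < t" "t < 1" for y t
  proof -
    have e: "cis (y * t) = cis (x * t) * cis ((y - x) * t)"
      by (simp add: cis_mult algebra_simps)
    have "cis (y * t) - cis (x * t) - (y - x) *\<^sub>R (\<i> * t * cis (x * t)) =
      cis (x * t) * (exp (\<i> * of_real ((y - x) * t)) - (\<Sum>k\<le>1. (\<i> * of_real ((y - x) * t)) ^ k / fact k))"
      unfolding e by (simp add: cis_conv_exp scaleR_conv_of_real algebra_simps)
    also have "norm \<dots> = norm (exp (\<i> * of_real ((y - x) * t)) - (\<Sum>k\<le>1. (\<i> * of_real ((y - x) * t)) ^ k / fact k))"
      by (simp only: norm_mult norm_cis mult_1)
    also have "\<dots> \<le> exp \<bar>Re (\<i> * of_real ((y - x) * t))\<bar> * norm (\<i> * of_real ((y - x) * t)) ^ Suc 1 / fact 1"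
      by (rule Taylor_exp)
    also have "\<dots> = (y - x)\<^sup>2 * t\<^sup>2"
    proof -
      have "norm (\<i> * of_real r) = \<bar>r\<bar>" "Re (\<i> * of_real r) = 0" for r by (simp_all add: norm_mult)
      then show ?thesis
        by (simp only: power_mult_distrib power2_abs fact_1 Suc_1 numeral_2_eq_2[symmetric] One_nat_def[symmetric] abs_zero exp_zero mult_1 div_by_1)
    qed
    also have "\<dots> \<le> (y - x)\<^sup>2 * 1"
      using that by (intro mult_left_mono) (auto simp: power_le_one)
    finally show ?thesis by simp
  qed
  have int: "integrable lborel (\<lambda>t. beta_weight a b t *\<^sub>R (\<i> * t * cis (x * t)))"
    by (rule integrable_beta_weight_scaleR[where C = 1]) (use assms in \<open>auto simp: norm_mult\<close>)
  have "\<i> * beta_fourier (a + 1) b x = (LINT t|lborel. \<i> * (beta_weight (a + 1) b t *\<^sub>R cis (x * t)))"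
    unfolding beta_fourier_def by (simp del: mult_scaleR_right)
  also have "\<dots> = (LINT t|lborel. beta_weight a b t *\<^sub>R (\<i> * t * cis (x * t)))"
    using beta_weight_shift_power[of _ 1 a b, symmetric]
    by (intro Bochner_Integration.integral_cong) (auto simp: scaleR_conv_of_real)
  finally have d: "\<i> * beta_fourier (a + 1) b x = \<dots>" .
  show "norm (beta_fourier a b y - beta_fourier a b x - (y - x) *\<^sub>R (\<i> * beta_fourier (a + 1) b x)) /
    norm (y - x) \<le> \<bar>y - x\<bar> * Beta a b" if "y \<noteq> x" for y
  proof -
    let ?h = "\<lambda>t. cis (y * t) - cis (x * t) - (y - x) *\<^sub>R (\<i> * t * cis (x * t))"
    have "beta_fourier a b y - beta_fourier a b x - (y - x) *\<^sub>R (\<i> * beta_fourier (a + 1) b x) =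
      (LINT t|lborel. beta_weight a b t *\<^sub>R cis (y * t) - beta_weight a b t *\<^sub>R cis (x * t) -
        (y - x) *\<^sub>R (beta_weight a b t *\<^sub>R (\<i> * t * cis (x * t))))"
      unfolding d unfolding beta_fourier_def
      using integrable_beta_fourier[OF assms] int by (simp del: scaleR_scaleR)
    also have "\<dots> = (LINT t|lborel. beta_weight a b t *\<^sub>R ?h t)"
      by (intro Bochner_Integration.integral_cong) (auto simp: algebra_simps)
    also have "norm \<dots> \<le> (LINT t|lborel. beta_weight a b t * (y - x)\<^sup>2)"
    proof (rule Bochner_Integration.integral_norm_bound_integral)
      show "integrable lborel (\<lambda>t. beta_weight a b t *\<^sub>R ?h t)"
        by (rule integrable_beta_weight_scaleR[where C = "(y-x)\<^sup>2"]) (use assms est in auto)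
      show "integrable lborel (\<lambda>t. beta_weight a b t * (y - x)\<^sup>2)"
        using integrable_beta_weight[OF assms] by simp
      show "norm (beta_weight a b t *\<^sub>R ?h t) \<le> beta_weight a b t * (y - x)\<^sup>2" for t
        using est[of t y] by (cases "0 < t \<and> t < 1") (auto simp: beta_weight_eq_0 intro: mult_left_mono)
    qed
    also have "\<dots> = Beta a b * \<bar>y - x\<bar>\<^sup>2"
      using integral_beta_weight[OF assms] by simp
    finally show ?thesis using that by (simp add: divide_simps power2_eq_square mult_ac)
  qed
  have "((\<lambda>y. \<bar>y - x\<bar> * Beta a b) \<longlongrightarrow> \<bar>x - x\<bar> * Beta a b) (at x)"
    by (intro tendsto_intros)
  then show "((\<lambda>y. \<bar>y - x\<bar> * Beta a b) \<longlongrightarrow> 0) (at x)" by simp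
qed (auto intro: bounded_linear_scaleR_left)

text \<open>Integrates the derivative of t^a (1 - t)^b e^(ixt); these exponents exceed those of the
  weight by one, so both boundary values vanish. With F = K a b one has F' = i K (a+1) b and F'' = -
  K (a+2) b, so this is Kummer's equation for F.\<close>

lemma kummer_relation:
  assumes "a > 0" "b > 0"
  shows "of_real x * beta_fourier (a + 2) b x =
    (x + \<i> * (a + b)) * beta_fourier (a + 1) b x - \<i> * a * beta_fourier a b x"
proof -
  define f where "f t = (of_real (t powr a * (1 - t) powr b) * cis (x * t) :: complex)" for t
  define f' where "f' t = beta_weight a b t *\<^sub>R ((of_real (a - (a + b) * t) + \<i> * of_real (x * (t - t\<^sup>2))) * cis (x * t))" for t
  \<comment> \<open>For parameters below 1 the derivative is unbounded at the ends while
    \<open>f\<close> stays continuous there, so differentiability is asked in the open interval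
    only.\<close>
  have "(f' has_integral f 1 - f 0) {0..1}"
  proof (rule fundamental_theorem_of_calculus_interior)
    show "continuous_on {0..1} f"
      unfolding f_def
      by (intro continuous_on_mult continuous_on_of_real continuous_on_powr' continuous_on_cis continuous_on_const
            continuous_on_id continuous_on_diff) (use assms in auto)
    show "(f has_vector_derivative f' t) (at t)" if "t \<in> {0<..<1}" for t
    proof -
      have 1: "t powr a = t powr (a - 1) * t" "(1 - t) powr b = (1 - t) powr (b - 1) * (1 - t)"
        using that powr_mult_base[of t "a - 1"] powr_mult_base[of "1 - t" "b - 1"] by (simp_all add: mult_ac)
      have p: "((\<lambda>t. t powr a * (1 - t) powr b) has_real_derivative
          t powr (a - 1) * (1 - t) powr (b - 1) * (a - (a + b) * t)) (at t)"
        by (rule DERIV_cong[OF DERIV_mult[OF has_real_derivative_powr DERIV_chain2[where g = "\<lambda>t. 1 - t", OF has_real_derivative_powr]]])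
           (auto intro!: derivative_eq_intros simp: 1 algebra_simps that[simplified])
      have c: "((\<lambda>t. cis (x * t)) has_vector_derivative x *\<^sub>R (\<i> * cis (x * t))) (at t)"
        unfolding has_vector_derivative_def by (auto intro!: derivative_eq_intros)
      show ?thesis unfolding f_def
        by (rule has_vector_derivative_eq_rhs[OF has_vector_derivative_mult[OF has_vector_derivative_of_real[OF p] c]])
          (use that in \<open>simp add: f'_def beta_weight_def scaleR_conv_of_real 1 algebra_simps power2_eq_square\<close>)
    qed
  qed simp
  then have z: "(f' has_integral 0) {0..1}" using assms by (simp add: f_def)
  have i: "integrable lborel f'" unfolding f'_def
  proof (rule integrable_beta_weight_scaleR[where C = "a + (a + b) + \<bar>x\<bar>"])
    fix t :: real assume t: "0 < t" "t < 1"
    have "norm ((of_real (a - (a + b) * t) + \<i> * of_real (x * (t - t\<^sup>2))) * cis (x * t)) \<le>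
       \<bar>a - (a + b) * t\<bar> + \<bar>x * (t - t\<^sup>2)\<bar>"
      unfolding norm_mult norm_cis mult_1_right
      by (rule order_trans[OF norm_triangle_ineq]) (simp add: norm_mult del: of_real_diff of_real_mult)
    also have "\<bar>a - (a + b) * t\<bar> \<le> a + (a + b)"
    proof -
      define s where "s = (a + b) * t"
      have "s \<le> (a + b) * 1" "0 \<le> s"
        unfolding s_def by (rule mult_left_mono mult_nonneg_nonneg; use t assms in simp)+
      then show ?thesis using assms unfolding s_def[symmetric] by (intro abs_leI) auto
    qed
    also have "\<bar>x * (t - t\<^sup>2)\<bar> \<le> \<bar>x\<bar> * 1"
    proof -
      have "t\<^sup>2 \<le> 1" "0 \<le> t\<^sup>2" using t by (auto simp: power_le_one)
      then have "\<bar>t - t\<^sup>2\<bar> \<le> 1" using t by linarith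
      then show ?thesis unfolding abs_mult by (rule mult_left_mono) simp
    qed
    finally show "norm ((of_real (a - (a + b) * t) + \<i> * of_real (x * (t - t\<^sup>2))) * cis (x * t)) \<le> a + (a + b) + \<bar>x\<bar>"
      by simp
  qed (use assms in auto)
  have "integral\<^sup>L lborel f' = 0"
  proof -
    have "(f' has_integral integral\<^sup>L lborel f') UNIV" by (rule has_integral_integral_lborel[OF i])
    moreover have "(f' has_integral 0) UNIV"
      using z by (rule has_integral_on_superset) (auto simp: f'_def beta_weight_eq_0)
    ultimately show ?thesis by (rule has_integral_unique)
  qed
  moreover have "integral\<^sup>L lborel f' = (LINT t|lborel. of_real a * (beta_weight a b t *\<^sub>R cis (x * t)) +
    (\<i> * x - (a + b)) * (beta_weight (a + 1) b t *\<^sub>R cis (x * t)) - \<i> * x * (beta_weight (a + 2) b t *\<^sub>R cis (x * t)))"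
    using beta_weight_shift_power[of _ 1 a b, symmetric] beta_weight_shift_power[of _ 2 a b, symmetric]
    by (intro Bochner_Integration.integral_cong) (auto simp: f'_def scaleR_conv_of_real algebra_simps power2_eq_square)
  moreover have "\<dots> = a * beta_fourier a b x + (\<i> * x - (a + b)) * beta_fourier (a + 1) b x - \<i> * x * beta_fourier (a + 2) b x"
    using integrable_beta_fourier[of a b x] integrable_beta_fourier[of "a + 1" b x]
      integrable_beta_fourier[of "a + 2" b x] assms
    unfolding beta_fourier_def by (simp del: mult_scaleR_right)
  ultimately have "\<i> * (a * beta_fourier a b x + (\<i> * x - (a + b)) * beta_fourier (a + 1) b x - \<i> * x * beta_fourier (a + 2) b x) = 0"
    by simp
  then show ?thesis by (simp add: algebra_simps)
qed

section \<open>The Wronskian and the counting of zeros\<close>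

text \<open>Write K for K (a+1) b and W = Re (cnj F * K). Kummer's equation gives x W' = a |F|^2 -
  (a + b) W - x Im (cnj F * K). The last term has no sign, but it is x times the derivative of |F|^2
  / 2: subtracting that half square removes it, and the factor x^(a+b) absorbs the term with
  W.\<close>

lemma wronskian_lower_bound:
  assumes b: "0 < b" and ab: "b \<le> a" and x: "0 < x"
  shows "(norm (beta_fourier a b x))\<^sup>2 / 2 \<le> Re (cnj (beta_fourier a b x) * beta_fourier (a + 1) b x)"
proof -
  define F K where "F = beta_fourier a b" and "K = beta_fourier (a + 1) b"
  define g where "g = a + b"
  have a: "a > 0" using assms by simp
  define G where "G x = x powr g * (Re (cnj (F x) * K x) - (norm (F x))\<^sup>2 / 2)" for x
  have dF: "(F has_vector_derivative \<i> * K x) (at x)" for x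
    unfolding F_def K_def using a b by (rule has_vector_derivative_beta_fourier)
  have dK: "(K has_vector_derivative \<i> * beta_fourier (a + 2) b x) (at x)" for x
    using has_vector_derivative_beta_fourier[of "a + 1" b x] a b by (simp add: K_def add.commute)
  define p q u v where "p x = Re (F x)" and "q x = Im (F x)" and "u x = Re (K x)" and "v x = Im (K x)" for x
  have d: "(p has_real_derivative - v x) (at x)" "(q has_real_derivative u x) (at x)"
          "(u has_real_derivative - Im (beta_fourier (a + 2) b x)) (at x)"
          "(v has_real_derivative Re (beta_fourier (a + 2) b x)) (at x)" for x
    using bounded_linear.has_vector_derivative[OF bounded_linear_Re dF[of x]]
      bounded_linear.has_vector_derivative[OF bounded_linear_Im dF[of x]]
      bounded_linear.has_vector_derivative[OF bounded_linear_Re dK[of x]]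
      bounded_linear.has_vector_derivative[OF bounded_linear_Im dK[of x]]
    by (simp_all add: has_real_derivative_iff_has_vector_derivative p_def[abs_def] q_def[abs_def] u_def[abs_def] v_def[abs_def])
  have Geq: "G = (\<lambda>x. x powr g * (p x * u x + q x * v x - ((p x)\<^sup>2 + (q x)\<^sup>2) / 2))"
    by (simp add: G_def fun_eq_iff cmod_power2 p_def q_def u_def v_def)
  have dG: "(G has_real_derivative y powr (g - 1) * (norm (F y))\<^sup>2 * ((a - b) / 2)) (at y)" if y: "y > 0" for y
  proof -
    define A where "A = beta_fourier (a + 2) b y"
    have k: "y * Re A = y * u y - g * v y + a * q y"
            "y * Im A = y * v y + g * u y - a * p y"
      using arg_cong[OF kummer_relation[OF a b, of y], of Re] arg_cong[OF kummer_relation[OF a b, of y], of Im]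
      by (simp_all add: A_def K_def F_def g_def p_def q_def u_def v_def algebra_simps)
    have pw: "y powr g = y powr (g - 1) * y" using y powr_mult_base[of y "g - 1"] by (simp add: mult.commute)
    let ?R = "p y * u y + q y * v y - ((p y)\<^sup>2 + (q y)\<^sup>2) / 2"
    have "(G has_real_derivative (g * y powr (g - 1)) * ?R +
       y powr g * (q y * Re A - p y * Im A + p y * v y - q y * u y)) (at y)"
      unfolding Geq
      by (rule DERIV_cong[OF DERIV_mult[OF has_real_derivative_powr]])
         (auto intro!: derivative_eq_intros d simp: y A_def field_simps)
    moreover have "(g * y powr (g - 1)) * ?R +
       y powr g * (q y * Re A - p y * Im A + p y * v y - q y * u y) =
       y powr (g - 1) * (g * ?R + q y * (y * Re A) - p y * (y * Im A) + y * (p y * v y - q y * u y))"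
      unfolding pw by (simp add: algebra_simps)
    moreover have "\<dots> = y powr (g - 1) * (norm (F y))\<^sup>2 * ((a - b) / 2)"
      unfolding k cmod_power2 p_def[symmetric] q_def[symmetric] by (simp add: g_def field_simps power2_eq_square)
    ultimately show ?thesis by simp
  qed
  have "G 0 \<le> G x"
  proof (rule DERIV_nonneg_imp_increasing_open[where f = G and a = 0 and b = x])
    show "\<exists>d. (G has_real_derivative d) (at y) \<and> 0 \<le> d" if "0 < y" "y < x" for y
      using ab by (intro exI[of _ "y powr (g - 1) * (norm (F y))\<^sup>2 * ((a - b) / 2)"] conjI dG that(1)) simp
    have c: "continuous_on {0..x} f" if "\<And>y. \<exists>d. (f has_vector_derivative d) (at y)" for f :: "real \<Rightarrow> complex"
      using that by (meson continuous_on_vector_derivative has_vector_derivative_at_within)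
    have "continuous_on {0..x} F" "continuous_on {0..x} K" using c dF dK by blast+
    then show "continuous_on {0..x} G" unfolding G_def
      by (intro continuous_intros continuous_on_powr') (use a b in \<open>auto simp: g_def\<close>)
  qed (use x in simp)
  \<comment> \<open>\<open>0 powr g\<close> is 0, which is also the limit from the right since g >
    0; thus \<open>G\<close> starts continuously at 0.\<close>
  moreover have "G 0 = 0" using a b by (simp add: G_def g_def)
  ultimately have "0 \<le> Re (cnj (F x) * K x) - (norm (F x))\<^sup>2 / 2"
    using x unfolding G_def by (simp add: zero_le_mult_iff)
  then show ?thesis by (simp add: F_def K_def)
qed

section \<open>Zeros that are all crossed upwards\<close>

text \<open>Just after x the function is positive. The first later point where it is no longer
  positive is a zero reached from above, so it cannot be crossed upwards.\<close>

lemma at_most_one_zero_if_increasing_at_zeros: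
  fixes f :: "real \<Rightarrow> real"
  assumes cont: "continuous_on {a<..<b} f"
    and inc: "\<And>x. a < x \<Longrightarrow> x < b \<Longrightarrow> f x = 0 \<Longrightarrow> \<exists>D>0. (f has_real_derivative D) (at x)"
    and xy: "a < x" "x < y" "y < b" "f x = 0" "f y = 0"
  shows False
proof -
  obtain D where "D > 0" "(f has_real_derivative D) (at x)" using inc[of x] xy by auto
  then obtain d where d: "d > 0" "\<And>h. h > 0 \<Longrightarrow> h < d \<Longrightarrow> f (x + h) > 0"
    using DERIV_pos_inc_right[of f D x] xy by auto
  define h where "h = min (d/2) ((y - x)/2)"
  have h: "0 < h" "h < d" "h \<le> (y - x)/2" unfolding h_def using d(1) xy by (simp_all add: min_def)
  define p where "p = x + h"
  have "h < y - x" using h(3) xy(2) by (simp add: field_simps)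
  then have p: "x < p" "p < y" "f p > 0" using d(2)[OF h(1,2)] h by (simp_all add: p_def)
  define S where "S = {p..y} \<inter> f -` {..0}"
  have "closed S" unfolding S_def
    by (intro continuous_closed_preimage continuous_on_subset[OF cont]) (use p xy in auto)
  moreover have "y \<in> S" "bdd_below S" using p xy by (auto simp: S_def intro: bdd_belowI)
  ultimately have z: "Inf S \<in> S" by (intro closed_contains_Inf) auto
  define z where "z = Inf S"
  have z: "p \<le> z" "z \<le> y" "f z \<le> 0" using z by (auto simp: z_def S_def)
  have low: "f t > 0" if "p \<le> t" "t < z" for t
  proof (rule ccontr)
    assume "\<not> f t > 0"
    then have "t \<in> S" using that z by (auto simp: S_def)
    then have "z \<le> t" unfolding z_def using \<open>bdd_below S\<close> by (rule cInf_lower)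
    then show False using that by simp
  qed
  have "p < z" using z p by (cases "p = z") auto
  have "f z = 0"
  proof (rule ccontr)
    assume "f z \<noteq> 0"
    then have "f z < 0" using z by simp
    have "\<exists>t\<ge>p. t \<le> z \<and> f t = 0"
      by (rule IVT2') (use \<open>f z < 0\<close> p z xy in \<open>auto intro!: continuous_on_subset[OF cont]\<close>)
    then obtain t where "p \<le> t" "t \<le> z" "f t = 0" by auto
    then show False using low[of t] \<open>f z \<noteq> 0\<close> by (cases "t = z") auto
  qed
  then obtain E where "E > 0" "(f has_real_derivative E) (at z)" using inc[of z] xy z p by auto
  then obtain e where e: "e > 0" "\<And>h. h > 0 \<Longrightarrow> h < e \<Longrightarrow> f (z - h) < 0"
    using DERIV_pos_inc_left[of f E z] \<open>f z = 0\<close> by auto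
  define h where "h = min (e/2) (z - p)"
  have "h > 0" "h < e" "h \<le> z - p" using e \<open>p < z\<close> by (auto simp: h_def)
  then show False using e(2)[of h] low[of "z - h"] by simp
qed

lemma one_zero_simpleI:
  assumes ab: "a < b" and cont: "continuous_on {a..b} f" and sgn: "f a < 0" "0 < f b"
    and inc: "\<And>x. a < x \<Longrightarrow> x < b \<Longrightarrow> f x = 0 \<Longrightarrow> \<exists>D>0. (f has_real_derivative D) (at x)"
  shows "one_zero_simple f {a<..<b}"
proof -
  have "\<exists>x\<ge>a. x \<le> b \<and> f x = 0"
    by (rule IVT') (use ab cont sgn in auto)
  then obtain x where "a \<le> x" "x \<le> b" and x: "f x = 0" by auto
  then have xab: "a < x" "x < b" using sgn by (auto simp: less_le)
  have c: "continuous_on {a<..<b} f" by (rule continuous_on_subset[OF cont]) auto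
  have ne: False if "a < u" "u < v" "v < b" "f u = 0" "f v = 0" for u v
    by (rule at_most_one_zero_if_increasing_at_zeros[OF c _ that]) (rule inc)
  show ?thesis unfolding one_zero_simple_def
  proof (intro conjI ballI impI ex1I[of _ x])
    show "y = x" if y: "y \<in> {a<..<b} \<and> f y = 0" for y
    proof (rule ccontr)
      assume "y \<noteq> x"
      then consider "x < y" | "y < x" by linarith
      then show False by cases (use ne[of x y] ne[of y x] x xab y in simp_all)
    qed
    show "simple_zero f y" if y: "y \<in> {a<..<b}" "f y = 0" for y
    proof -
      obtain D where "D > 0" "(f has_real_derivative D) (at y)" using inc[of y] y by auto
      then show ?thesis unfolding simple_zero_def using that by (intro conjI exI[of _ D]) auto
    qed
  qed (use x xab in auto)
qed

lemma one_zero_simple_cmult: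
  assumes "c \<noteq> 0" shows "one_zero_simple (\<lambda>x. c * f x) S \<longleftrightarrow> one_zero_simple f S"
proof -
  have *: "simple_zero f x \<Longrightarrow> simple_zero (\<lambda>x. c * f x) x" if "c \<noteq> 0" for c :: real and f x
    unfolding simple_zero_def using that DERIV_cmult by fastforce
  have "simple_zero (\<lambda>x. c * f x) x \<longleftrightarrow> simple_zero f x" for x
    using *[OF assms, of f x] *[of "1 / c" "\<lambda>x. c * f x" x] assms by auto
  then show ?thesis unfolding one_zero_simple_def using assms by simp
qed

lemma one_zero_simple_subset:
  assumes "one_zero_simple f S" "T \<subseteq> S" "x \<in> T" "f x = 0"
  shows "one_zero_simple f T"
  using assms unfolding one_zero_simple_def by blast

lemma sin_cos_half_shift:
  fixes k :: nat
  shows "sin ((real k + 1/2) * pi) = (-1) ^ k" "sin ((real k - 1/2) * pi) = - ((-1) ^ k)"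
    "cos ((real k + 1/2) * pi) = 0" "cos ((real k - 1/2) * pi) = 0"
proof -
  have e: "(real k + 1/2) * pi = real k * pi + pi/2" "(real k - 1/2) * pi = real k * pi - pi/2"
    by (simp_all add: algebra_simps)
  show "sin ((real k + 1/2) * pi) = (-1) ^ k" "sin ((real k - 1/2) * pi) = - ((-1) ^ k)"
    "cos ((real k + 1/2) * pi) = 0" "cos ((real k - 1/2) * pi) = 0"
    unfolding e by (simp_all add: sin_add cos_add sin_diff cos_diff cos_npi2 mult.commute[of _ pi] del: cos_npi sin_npi cos_npi2, simp_all)
qed

lemma power_minus_one_cos_pos:
  assumes "(real k - 1/2) * pi < x" "x < (real k + 1/2) * pi"
  shows "0 < (-1) ^ k * cos x"
proof -
  have "cos (x - real k * pi) > 0" using assms by (intro cos_gt_zero_pi) (auto simp: algebra_simps)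
  then show ?thesis by (simp add: cos_diff mult.commute)
qed

lemma power_minus_one_sin_pos:
  assumes "real k * pi < x" "x < (real k + 1) * pi"
  shows "0 < (-1) ^ k * sin x"
proof -
  have "sin (x - real k * pi) > 0" using assms by (intro sin_gt_zero) (auto simp: algebra_simps)
  then show ?thesis by (simp add: sin_diff mult.commute)
qed

section \<open>Zeros of a rotating pair\<close>

text \<open>P + iQ = e^(ix) (U - iV): a point of the lower half plane, rotated by the angle x. Only
  signs enter, nothing about beta weights; \<open>P_pos\<close> and \<open>Q_pos\<close> exclude
  zeros before the first interval.\<close>

locale phase_pair =
  fixes P Q P' Q' U V :: "real \<Rightarrow> real"
  assumes dP: "x > 0 \<Longrightarrow> (P has_real_derivative P' x) (at x)"
    and dQ: "x > 0 \<Longrightarrow> (Q has_real_derivative Q' x) (at x)"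
    and wronskian_pos: "x > 0 \<Longrightarrow> 0 < P x * Q' x - Q x * P' x"
    and P_eq: "P x = cos x * U x + sin x * V x"
    and Q_eq: "Q x = sin x * U x - cos x * V x"
    and V_pos: "x > 0 \<Longrightarrow> V x > 0"
    and P_pos: "0 < x \<Longrightarrow> x \<le> pi/2 \<Longrightarrow> P x > 0"
    and Q_pos: "0 < x \<Longrightarrow> x \<le> pi \<Longrightarrow> Q x > 0"
begin

lemma V_eq: "V x = sin x * P x - cos x * Q x"
proof -
  have "sin x * P x - cos x * Q x = ((sin x)\<^sup>2 + (cos x)\<^sup>2) * V x"
    unfolding P_eq Q_eq by (simp only: power2_eq_square ring_distribs mult_ac)
  then show ?thesis by simp
qed

lemma continuous_P: "a > 0 \<Longrightarrow> continuous_on {a..b} P"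
  by (rule DERIV_continuous_on[where D = P']) (use dP in \<open>auto intro: has_field_derivative_at_within\<close>)

lemma continuous_Q: "a > 0 \<Longrightarrow> continuous_on {a..b} Q"
  by (rule DERIV_continuous_on[where D = Q']) (use dQ in \<open>auto intro: has_field_derivative_at_within\<close>)

text \<open>At a zero of P both V and the Wronskian are multiples of Q, namely - cos x * Q and - P'
  * Q. Eliminating Q ties the sign of P' to that of cos x; for Q in the same way sin x
  appears.\<close>

lemma P_zero_deriv:
  assumes "x > 0" "P x = 0" shows "P' x * V x = cos x * (P x * Q' x - Q x * P' x)"
  using assms by (simp add: V_eq)

lemma Q_zero_deriv:
  assumes "x > 0" "Q x = 0" shows "Q' x * V x = sin x * (P x * Q' x - Q x * P' x)"
  using assms by (simp add: V_eq)

lemma deriv_sgn: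
  assumes "D * V x = c * w" "w > 0" "x > 0" "0 < s * c" shows "0 < s * (D :: real)"
proof -
  have "s * D * V x = (s * c) * w" using assms(1) by simp
  also have "\<dots> > 0" using assms by simp
  finally show ?thesis using V_pos[OF assms(3)] by (simp add: zero_less_mult_iff)
qed

lemma one_zero_P:
  assumes k: "k \<ge> (1::nat)"
  shows "one_zero_simple P {(real k - 1/2) * pi <..< (real k + 1/2) * pi}"
proof -
  have "real k \<ge> 1" using k by simp
  then have pos: "(real k - 1/2) * pi > 0" by simp
  have pos2: "(real k + 1/2) * pi > 0" by simp
  \<comment> \<open>On this interval cos has the sign (-1)^k, so this factor turns every crossing
    into an upward one; at the two ends cos vanishes and only V decides.\<close>
  have "one_zero_simple (\<lambda>x. (-1) ^ k * P x) {(real k - 1/2) * pi <..< (real k + 1/2) * pi}"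
  proof (rule one_zero_simpleI)
    show "(- 1) ^ k * P ((real k - 1/2) * pi) < 0" "0 < (- 1) ^ k * P ((real k + 1/2) * pi)"
      unfolding P_eq sin_cos_half_shift using V_pos[OF pos] V_pos[OF pos2]
      by (simp_all add: mult.assoc[symmetric] power_mult_distrib[symmetric])
    fix x assume x: "(real k - 1/2) * pi < x" "x < (real k + 1/2) * pi" "(-1) ^ k * P x = 0"
    then have "x > 0" "P x = 0" using pos by auto
    then have "0 < (-1) ^ k * P' x"
      using deriv_sgn[OF P_zero_deriv wronskian_pos] power_minus_one_cos_pos[OF x(1,2)] by blast
    then show "\<exists>D>0. ((\<lambda>x. (- 1) ^ k * P x) has_real_derivative D) (at x)"
      using DERIV_cmult[OF dP[OF \<open>x > 0\<close>]] by blast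
  qed (use pos in \<open>auto intro!: continuous_intros continuous_P\<close>)
  then show ?thesis by (subst (asm) one_zero_simple_cmult) auto
qed

lemma one_zero_Q:
  assumes k: "k \<ge> (1::nat)"
  shows "one_zero_simple Q {real k * pi <..< (real k + 1) * pi}"
proof -
  have pos: "real k * pi > 0" "(real k + 1) * pi > 0" using k by auto
  have e: "(real k + 1) * pi = real (Suc k) * pi" by simp
  have "one_zero_simple (\<lambda>x. (-1) ^ k * Q x) {real k * pi <..< (real k + 1) * pi}"
  proof (rule one_zero_simpleI)
    show "(- 1) ^ k * Q (real k * pi) < 0"
      unfolding Q_eq using V_pos[OF pos(1)]
      by (simp add: mult.assoc[symmetric] power_mult_distrib[symmetric])
    show "0 < (- 1) ^ k * Q ((real k + 1) * pi)"
      unfolding Q_eq using V_pos[OF pos(2)] unfolding e cos_npi sin_npi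
      by (simp add: mult.assoc[symmetric] power_mult_distrib[symmetric])
    fix x assume x: "real k * pi < x" "x < (real k + 1) * pi" "(-1) ^ k * Q x = 0"
    then have "x > 0" "Q x = 0" using pos by auto
    then have "0 < (-1) ^ k * Q' x"
      using deriv_sgn[OF Q_zero_deriv wronskian_pos] power_minus_one_sin_pos[OF x(1,2)] by blast
    then show "\<exists>D>0. ((\<lambda>x. (- 1) ^ k * Q x) has_real_derivative D) (at x)"
      using DERIV_cmult[OF dQ[OF \<open>x > 0\<close>]] by blast
  qed (use pos in \<open>auto intro!: continuous_intros continuous_Q\<close>)
  then show ?thesis by (subst (asm) one_zero_simple_cmult) auto
qed

text \<open>The intervals tile the half line beyond pi/2 up to their common end points, and there P
  equals V up to sign, hence is not zero.\<close>

lemma P_zero_location: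
  assumes "x > 0" "P x = 0"
  shows "\<exists>k::nat. k \<ge> 1 \<and> x \<in> {(real k - 1/2) * pi <..< (real k + 1/2) * pi}"
proof -
  have x: "x > pi/2" using P_pos[of x] assms by force
  define k where "k = nat \<lfloor>x / pi + 1/2\<rfloor>"
  have "x / pi + 1/2 \<ge> 1" using x by (simp add: field_simps)
  then have k1: "k \<ge> 1" unfolding k_def by (simp add: le_nat_iff le_floor_iff)
  have "real k = of_int \<lfloor>x / pi + 1/2\<rfloor>" unfolding k_def using \<open>x / pi + 1/2 \<ge> 1\<close> by (intro of_nat_nat) linarith
  then have "real k \<le> x / pi + 1/2" "x / pi + 1/2 < real k + 1" by linarith+
  then have k: "(real k - 1/2) * pi \<le> x" "x < (real k + 1/2) * pi" by (simp_all add: field_simps)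
  have "P ((real k - 1/2) * pi) \<noteq> 0"
    unfolding P_eq sin_cos_half_shift using V_pos[of "(real k - 1/2) * pi"] k1 by simp
  then have "x \<noteq> (real k - 1/2) * pi" using assms by auto
  with k k1 show ?thesis by (intro exI[of _ k]) auto
qed

lemma Q_zero_location:
  assumes "x > 0" "Q x = 0"
  shows "\<exists>k::nat. k \<ge> 1 \<and> x \<in> {real k * pi <..< (real k + 1) * pi}"
proof -
  have x: "x > pi" using Q_pos[of x] assms by force
  define k where "k = nat \<lfloor>x / pi\<rfloor>"
  have "x / pi \<ge> 1" using x by (simp add: field_simps)
  then have k1: "k \<ge> 1" unfolding k_def by linarith
  have "real k = of_int \<lfloor>x / pi\<rfloor>" unfolding k_def using \<open>x / pi \<ge> 1\<close> by (intro of_nat_nat) linarith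
  then have "real k \<le> x / pi" "x / pi < real k + 1" by linarith+
  then have k: "real k * pi \<le> x" "x < (real k + 1) * pi" by (simp_all add: field_simps)
  have "Q (real k * pi) \<noteq> 0"
    unfolding Q_eq using V_pos[of "real k * pi"] k1 by simp
  then have "x \<noteq> real k * pi" using assms by auto
  with k k1 show ?thesis by (intro exI[of _ k]) auto
qed

lemma no_common_zero: "x > 0 \<Longrightarrow> \<not> (P x = 0 \<and> Q x = 0)"
  using V_pos[of x] V_eq[of x] by auto

context
  assumes U_pos: "\<And>x. x > 0 \<Longrightarrow> U x > 0"
begin

lemma P_zero_left_half:
  assumes k: "k \<ge> (1::nat)"
  shows "\<exists>x \<in> {(real k - 1/2) * pi <..< real k * pi}. P x = 0"
proof -
  have "real k \<ge> 1" using k by simp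
  then have pos: "(real k - 1/2) * pi > 0" "real k * pi > 0" by simp_all
  let ?f = "\<lambda>x. (-1) ^ k * P x"
  have s: "?f ((real k - 1/2) * pi) < 0" "0 < ?f (real k * pi)"
    unfolding P_eq sin_cos_half_shift using V_pos[OF pos(1)] U_pos[OF pos(2)]
    by (simp_all add: mult.assoc[symmetric] power_mult_distrib[symmetric])
  have "\<exists>x\<ge>(real k - 1/2) * pi. x \<le> real k * pi \<and> ?f x = 0"
    by (rule IVT') (use s pos in \<open>auto intro!: continuous_intros continuous_P\<close>)
  then obtain x where x: "x \<ge> (real k - 1/2) * pi" "x \<le> real k * pi" "?f x = 0" by auto
  moreover have "x \<noteq> (real k - 1/2) * pi" "x \<noteq> real k * pi" using s x by auto
  ultimately show ?thesis by (intro bexI[of _ x]) auto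
qed

lemma Q_zero_left_half:
  assumes k: "k \<ge> (1::nat)"
  shows "\<exists>x \<in> {real k * pi <..< (real k + 1/2) * pi}. Q x = 0"
proof -
  have pos: "(real k + 1/2) * pi > 0" "real k * pi > 0" using k by simp_all
  let ?f = "\<lambda>x. (-1) ^ k * Q x"
  have s: "?f (real k * pi) < 0" "0 < ?f ((real k + 1/2) * pi)"
    unfolding Q_eq sin_cos_half_shift using V_pos[OF pos(2)] U_pos[OF pos(1)]
    by (simp_all add: mult.assoc[symmetric] power_mult_distrib[symmetric])
  have "\<exists>x\<ge>real k * pi. x \<le> (real k + 1/2) * pi \<and> ?f x = 0"
    by (rule IVT') (use s pos in \<open>auto intro!: continuous_intros continuous_Q\<close>)
  then obtain x where x: "x \<ge> real k * pi" "x \<le> (real k + 1/2) * pi" "?f x = 0" by auto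
  moreover have "x \<noteq> (real k + 1/2) * pi" "x \<noteq> real k * pi" using s x by auto
  ultimately show ?thesis by (intro bexI[of _ x]) auto
qed

lemma one_zero_P_left_half:
  assumes k: "k \<ge> (1::nat)"
  shows "one_zero_simple P {(real k - 1/2) * pi <..< real k * pi}"
proof -
  obtain x where "x \<in> {(real k - 1/2) * pi <..< real k * pi}" "P x = 0"
    using P_zero_left_half[OF k] by blast
  then show ?thesis
    by (intro one_zero_simple_subset[OF one_zero_P[OF k]]) (auto simp: algebra_simps)
qed

lemma one_zero_Q_left_half:
  assumes k: "k \<ge> (1::nat)"
  shows "one_zero_simple Q {real k * pi <..< (real k + 1/2) * pi}"
proof -
  obtain x where "x \<in> {real k * pi <..< (real k + 1/2) * pi}" "Q x = 0"
    using Q_zero_left_half[OF k] by blast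
  then show ?thesis
    by (intro one_zero_simple_subset[OF one_zero_Q[OF k]]) (auto simp: algebra_simps)
qed

text \<open>The right half needs no sign argument of its own: the only zero of the full interval is
  the one already found in the left half.\<close>

lemma P_zero_location_left_half:
  assumes "x > 0" "P x = 0"
  shows "\<exists>k::nat. k \<ge> 1 \<and> x \<in> {(real k - 1/2) * pi <..< real k * pi}"
proof -
  obtain k :: nat where k: "k \<ge> 1" "x \<in> {(real k - 1/2) * pi <..< (real k + 1/2) * pi}"
    using P_zero_location[OF assms] by auto
  obtain y where y: "y \<in> {(real k - 1/2) * pi <..< real k * pi}" "P y = 0"
    using P_zero_left_half[OF k(1)] by blast
  then have "y \<in> {(real k - 1/2) * pi <..< (real k + 1/2) * pi}" by (auto simp: algebra_simps)
  then have "x = y" using one_zero_P[OF k(1)] k(2) assms(2) y(2) unfolding one_zero_simple_def by blast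
  with y k show ?thesis by blast
qed

lemma Q_zero_location_left_half:
  assumes "x > 0" "Q x = 0"
  shows "\<exists>k::nat. k \<ge> 1 \<and> x \<in> {real k * pi <..< (real k + 1/2) * pi}"
proof -
  obtain k :: nat where k: "k \<ge> 1" "x \<in> {real k * pi <..< (real k + 1) * pi}"
    using Q_zero_location[OF assms] by auto
  obtain y where y: "y \<in> {real k * pi <..< (real k + 1/2) * pi}" "Q y = 0"
    using Q_zero_left_half[OF k(1)] by blast
  then have "y \<in> {real k * pi <..< (real k + 1) * pi}" by (auto simp: algebra_simps)
  then have "x = y" using one_zero_Q[OF k(1)] k(2) assms(2) y(2) unfolding one_zero_simple_def by blast
  with y k show ?thesis by blast
qed

end

end

section \<open>Deformation to vertical rays\<close>

definition gamma_weight :: "real \<Rightarrow> real \<Rightarrow> real \<Rightarrow> real" where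
  "gamma_weight p x u = (if 0 < u then u powr (p - 1) * exp (- x * u) else 0)"

lemma gamma_weight_measurable [measurable]: "gamma_weight p x \<in> borel_measurable borel"
  unfolding gamma_weight_def [abs_def] by measurable

lemma gamma_weight_nonneg [simp]: "0 \<le> gamma_weight p x u"
  by (simp add: gamma_weight_def)

lemma has_bochner_integral_gamma_weight:
  assumes p: "p > 0" and x: "x > 0"
  shows "has_bochner_integral lborel (gamma_weight p x) (Gamma p * x powr - p)"
proof -
  have "((\<lambda>t. if t \<in> {0..} then t powr (p - 1) / exp t else 0) has_integral Gamma p) UNIV"
    using Gamma_integral_real[OF p] by (subst has_integral_restrict_UNIV)
  then have "(gamma_weight p 1 has_integral Gamma p) UNIV"
    by (rule has_integral_spike_finite[of "{0}", rotated 2]) (auto simp: gamma_weight_def exp_minus field_simps)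
  then have "has_bochner_integral lborel (gamma_weight p 1) (Gamma p)"
    by (intro has_bochner_integral_lborel_nonneg) auto
  then have "has_bochner_integral lborel (\<lambda>u. gamma_weight p 1 (0 + x * u)) (Gamma p /\<^sub>R \<bar>x\<bar>)"
    using x by (subst (asm) lborel_has_bochner_integral_real_affine_iff[of x _ _ 0]) auto
  then have "has_bochner_integral lborel (\<lambda>u. x powr (1 - p) * gamma_weight p 1 (0 + x * u)) (x powr (1 - p) * (Gamma p /\<^sub>R \<bar>x\<bar>))"
    by (rule has_bochner_integral_mult_right)
  moreover have "(\<lambda>u. x powr (1 - p) * gamma_weight p 1 (0 + x * u)) = gamma_weight p x"
    using x by (auto simp: gamma_weight_def fun_eq_iff powr_mult zero_less_mult_iff mult.assoc[symmetric] powr_add[symmetric])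
  moreover have "x powr (1 - p) * (Gamma p /\<^sub>R \<bar>x\<bar>) = Gamma p * x powr - p"
    using x by (simp add: powr_diff powr_minus field_simps)
  ultimately show ?thesis by (simp only:)
qed

lemma integrable_gamma_weight: "p > 0 \<Longrightarrow> x > 0 \<Longrightarrow> integrable lborel (gamma_weight p x)"
  using has_bochner_integral_gamma_weight by (auto simp: has_bochner_integral_iff)

lemma integral_gamma_weight:
  "p > 0 \<Longrightarrow> x > 0 \<Longrightarrow> integral\<^sup>L lborel (gamma_weight p x) = Gamma p * x powr - p"
  using has_bochner_integral_gamma_weight by (auto simp: has_bochner_integral_iff)

text \<open>The inequality ln y \<le> y - 1 at y = s (1 + u). The scale s = d / (|q| + 1) makes |q|
  s \<le> d, and the added 1 covers q = 0.\<close>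

lemma powr_le_exp_bound:
  fixes d q :: real
  assumes d: "d > 0"
  obtains C where "C \<ge> 0" "\<And>u. u \<ge> 0 \<Longrightarrow> (1 + u) powr q \<le> C * exp (d * u)"
proof
  define r s where "r = \<bar>q\<bar>" and "s = d / (\<bar>q\<bar> + 1)"
  have s: "s > 0" "r * s \<le> d" "r \<ge> 0" "q \<le> r" using d by (auto simp: s_def r_def field_simps)
  show "exp (r * (s - 1 - ln s)) \<ge> 0" by simp
  fix u :: real assume u: "u \<ge> 0"
  have "ln (s * (1 + u)) \<le> s * (1 + u) - 1" using s u by (intro ln_le_minus_one) auto
  moreover have "ln (s * (1 + u)) = ln s + ln (1 + u)" using s u by (simp add: ln_mult_pos)
  ultimately have "ln (1 + u) \<le> (s - 1 - ln s) + s * u" by (simp add: algebra_simps)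
  then have "r * ln (1 + u) \<le> r * ((s - 1 - ln s) + s * u)" using s by (intro mult_left_mono)
  also have "\<dots> \<le> r * (s - 1 - ln s) + d * u"
    using mult_right_mono[OF s(2) u] by (simp add: algebra_simps)
  finally have "exp (r * ln (1 + u)) \<le> exp (r * (s - 1 - ln s) + d * u)" by simp
  moreover have "(1 + u) powr q \<le> (1 + u) powr r" using u s by (intro powr_mono) auto
  ultimately have "(1 + u) powr q \<le> exp (r * (s - 1 - ln s) + d * u)"
    using u by (metis (no_types, lifting) add_pos_nonneg order_trans powr_def zero_less_one less_irrefl)
  then show "(1 + u) powr q \<le> exp (r * (s - 1 - ln s)) * exp (d * u)"
    by (simp only: exp_add)
qed

lemma powr_le_add_of_between:
  fixes c q r d :: real
  assumes "0 < c" "c \<le> r" "r \<le> d"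
  shows "r powr q \<le> c powr q + d powr q"
proof (cases "q \<ge> 0")
  case True
  then have "r powr q \<le> d powr q" using assms by (intro powr_mono2) auto
  then show ?thesis by (simp add: add_increasing)
next
  case False
  then have "r powr q \<le> c powr q" using assms by (intro powr_mono2') auto
  then show ?thesis by (simp add: add_increasing2)
qed

text \<open>One bound for all vertical lines close to a ray: r is the distance to the end point at
  which the ray starts, s the distance to the other one. Exponents of either sign are covered by
  adding the values at both ends of the range. The growth of the two powers is absorbed by two
  factors e^(xu/4), which leaves the decay rate x/2.\<close>

lemma ray_dominated:
  fixes a b x :: real
  assumes x: "x > 0"
  obtains C where "C \<ge> 0"
    "\<And>u r s. \<lbrakk>0 < u; u \<le> r; r \<le> 1 + u; 1/2 \<le> s; s \<le> 1 + u\<rbrakk> \<Longrightarrow>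
       r powr (a - 1) * s powr (b - 1) * exp (- x * u) \<le> C * (gamma_weight a (x/2) u + gamma_weight 1 (x/2) u)"
proof -
  obtain A where A: "A \<ge> 0" "\<And>u. u \<ge> 0 \<Longrightarrow> (1 + u) powr (a - 1) \<le> A * exp (x/4 * u)"
    using powr_le_exp_bound[of "x/4" "a - 1"] x by auto
  obtain B where B: "B \<ge> 0" "\<And>u. u \<ge> 0 \<Longrightarrow> (1 + u) powr (b - 1) \<le> B * exp (x/4 * u)"
    using powr_le_exp_bound[of "x/4" "b - 1"] x by auto
  define c where "c = (1/2 :: real) powr (b - 1)"
  have c: "c \<ge> 0" by (simp add: c_def)
  show ?thesis
  proof
    show "(1 + A) * (c + B) \<ge> 0" using A B c by simp
    fix u r s :: real
    assume u: "0 < u" and r: "u \<le> r" "r \<le> 1 + u" and s: "1/2 \<le> s" "s \<le> 1 + u"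
    define E where "E = exp (x/4 * u)"
    have E: "E \<ge> 1" using x u by (simp add: E_def)
    have "r powr (a - 1) \<le> u powr (a - 1) + (1 + u) powr (a - 1)"
      by (rule powr_le_add_of_between) (use u r in auto)
    also have "\<dots> \<le> u powr (a - 1) * E + A * E"
      using A(2)[of u, folded E_def] u mult_left_mono[OF E, of "u powr (a - 1)"] by (intro add_mono) auto
    finally have 1: "r powr (a - 1) \<le> (u powr (a - 1) + A) * E" by (simp add: algebra_simps)
    have "s powr (b - 1) \<le> c + (1 + u) powr (b - 1)"
      unfolding c_def by (rule powr_le_add_of_between) (use s in auto)
    also have "\<dots> \<le> c * E + B * E"
      using B(2)[of u, folded E_def] u mult_left_mono[OF E c] by (intro add_mono) auto
    finally have 2: "s powr (b - 1) \<le> (c + B) * E" by (simp add: algebra_simps)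
    have "r powr (a - 1) * s powr (b - 1) * exp (- x * u) \<le> ((u powr (a - 1) + A) * E) * ((c + B) * E) * exp (- x * u)"
      using 1 2 A B c E by (intro mult_right_mono mult_mono) auto
    also have "\<dots> = (c + B) * (u powr (a - 1) + A) * (E * E * exp (- x * u))" by simp
    also have "E * E * exp (- x * u) = exp (- (x/2) * u)"
      by (simp add: E_def exp_add[symmetric])
    also have "(c + B) * (u powr (a - 1) + A) * exp (- (x/2) * u) \<le>
        (c + B) * ((1 + A) * (u powr (a - 1) + 1)) * exp (- (x/2) * u)"
      using A B c by (intro mult_right_mono mult_left_mono) (auto simp: algebra_simps)
    also have "\<dots> = (1 + A) * (c + B) * (gamma_weight a (x/2) u + gamma_weight 1 (x/2) u)"
      using u by (simp add: gamma_weight_def algebra_simps)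
    finally show "r powr (a - 1) * s powr (b - 1) * exp (- x * u) \<le> \<dots>" .
  qed
qed

lemma norm_powr_of_real: "z \<noteq> 0 \<Longrightarrow> norm (z powr of_real p) = norm z powr p" for z :: complex
  by (simp add: powr_def)

lemma integral_segment_primitive:
  fixes h p :: "complex \<Rightarrow> complex"
  assumes "c \<le> d" and p: "\<And>z. z \<in> S \<Longrightarrow> (p has_field_derivative h z) (at z)"
    and h: "continuous_on S h" and S: "\<And>t. c \<le> t \<Longrightarrow> t \<le> d \<Longrightarrow> z + of_real t * w \<in> S"
  shows "(LINT t|lborel. indicator {c..d} t *\<^sub>R (w * h (z + of_real t * w))) =
    p (z + of_real d * w) - p (z + of_real c * w)"
proof (rule integral_FTC_atLeastAtMost[OF \<open>c \<le> d\<close>])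
  fix t assume t: "c \<le> t" "t \<le> d"
  have "((\<lambda>t. z + of_real t * w) has_vector_derivative w) (at t)"
    by (auto intro!: derivative_eq_intros simp: has_vector_derivative_def scaleR_conv_of_real)
  from field_vector_diff_chain_at[OF this p[OF S[OF t]]]
  show "((\<lambda>t. p (z + of_real t * w)) has_vector_derivative w * h (z + of_real t * w)) (at t within {c..d})"
    by (simp add: o_def has_vector_derivative_at_within)
next
  show "continuous_on {c..d} (\<lambda>t. w * h (z + of_real t * w))"
    by (intro continuous_intros continuous_on_compose2[OF h]) (use S in auto)
qed

section \<open>The rectangle in the strip and its limit\<close>

locale beta_contour =
  fixes a b x :: real
  assumes a: "a > 0" and b: "b > 0" and x: "x > 0"
begin

text \<open>The cuts of the principal powers, where z or 1 - z is real and nonpositive, avoid both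
  the strip and the open upper half plane.\<close>

definition h :: "complex \<Rightarrow> complex" where
  "h z = z powr of_real (a - 1) * (1 - z) powr of_real (b - 1) * exp (\<i> * of_real x * z)"

definition strip :: "complex set" where
  "strip = {z. 0 < Re z \<and> Re z < 1}"

text \<open>The rectangles with real part in [e n, 1 - e n] and imaginary part in [0, R n] exhaust
  the upper half of the strip. The offset 3 gives e n \<le> 1/3 for every n, so the left side stays
  to the left of the right one, and each stays at distance at least 1/2 from the opposite end point,
  as \<open>ray_dominated\<close> requires.\<close>

definition e :: "nat \<Rightarrow> real" where "e n = 1 / (real n + 3)"
definition R :: "nat \<Rightarrow> real" where "R n = real n + 3"

lemma e: "0 < e n" "e n \<le> 1/3" by (auto simp: e_def field_simps)
lemma R: "R n \<ge> 3" by (simp add: R_def)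
lemma e_lim: "e \<longlonglongrightarrow> 0" unfolding e_def by real_asymp
lemma R_lim: "filterlim R at_top sequentially" unfolding R_def by real_asymp

lemma h_continuous: "continuous_on strip h"
  unfolding h_def by (intro continuous_intros) (auto simp: strip_def complex_nonpos_Reals_iff)

text \<open>Covers the limit rays themselves, which lie on the boundary of the strip.\<close>

lemma h_isCont: "Im z > 0 \<Longrightarrow> isCont h z"
  unfolding h_def by (intro continuous_intros) (auto simp: complex_nonpos_Reals_iff)

lemma obtain_primitive:
  obtains p where "\<And>z. z \<in> strip \<Longrightarrow> (p has_field_derivative h z) (at z)"
proof -
  have S: "strip = {z. 0 < Re z} \<inter> {z. Re z < 1}" by (auto simp: strip_def)
  have c: "convex strip" "open strip" unfolding S
    by (intro convex_Int convex_halfspace_Re_gt convex_halfspace_Re_lt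
          open_Int open_halfspace_Re_gt open_halfspace_Re_lt)+
  have "h holomorphic_on strip"
    unfolding h_def by (intro holomorphic_intros) (auto simp: strip_def complex_nonpos_Reals_iff)
  from holomorphic_convex_primitive'[OF c this] obtain p
    where "\<And>z. z \<in> strip \<Longrightarrow> (p has_field_derivative h z) (at z within strip)" by blast
  then show ?thesis using at_within_open[OF _ c(2)] by (intro that[of p]) simp
qed

text \<open>The strip is convex, so the integrand has a primitive there; every side becomes a
  difference of corner values, and the four sides telescope.\<close>

lemma rectangle:
  "(LINT t|lborel. indicator {e n..1 - e n} t *\<^sub>R h (of_real t)) =
   (LINT u|lborel. indicator {0..R n} u *\<^sub>R (\<i> * h (of_real (e n) + of_real u * \<i>))) +
   (LINT t|lborel. indicator {e n..1 - e n} t *\<^sub>R h (of_real (R n) * \<i> + of_real t)) -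
   (LINT u|lborel. indicator {0..R n} u *\<^sub>R (\<i> * h (of_real (1 - e n) + of_real u * \<i>)))"
proof -
  obtain p where p: "\<And>z. z \<in> strip \<Longrightarrow> (p has_field_derivative h z) (at z)"
    using obtain_primitive by blast
  note seg = integral_segment_primitive[OF _ p h_continuous]
  have ee: "e n \<le> 1 - e n" "0 \<le> R n" using e[of n] R[of n] by linarith+
  have 1: "(LINT t|lborel. indicator {e n..1 - e n} t *\<^sub>R h (of_real t)) = p (of_real (1 - e n)) - p (of_real (e n))"
    using seg[OF ee(1), of 0 1] e[of n] by (simp add: strip_def)
  have 2: "(LINT u|lborel. indicator {0..R n} u *\<^sub>R (\<i> * h (of_real (e n) + of_real u * \<i>))) =
      p (of_real (e n) + of_real (R n) * \<i>) - p (of_real (e n))"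
    using seg[OF ee(2), of "of_real (e n)" \<i>] e[of n] by (simp add: strip_def)
  have 3: "(LINT u|lborel. indicator {0..R n} u *\<^sub>R (\<i> * h (of_real (1 - e n) + of_real u * \<i>))) =
      p (of_real (1 - e n) + of_real (R n) * \<i>) - p (of_real (1 - e n))"
    using seg[OF ee(2), of "of_real (1 - e n)" \<i>] e[of n] by (simp add: strip_def)
  have 4: "(LINT t|lborel. indicator {e n..1 - e n} t *\<^sub>R h (of_real (R n) * \<i> + of_real t)) =
      p (of_real (R n) * \<i> + of_real (1 - e n)) - p (of_real (R n) * \<i> + of_real (e n))"
    using seg[OF ee(1), of "of_real (R n) * \<i>" 1] e[of n] by (simp add: strip_def)
  show ?thesis unfolding 1 2 3 4 by (simp add: add.commute)
qed

lemma norm_h: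
  "z \<noteq> 0 \<Longrightarrow> z \<noteq> 1 \<Longrightarrow> norm (h z) = norm z powr (a - 1) * norm (1 - z) powr (b - 1) * exp (- x * Im z)"
  unfolding h_def by (simp add: norm_mult norm_powr_of_real del: of_real_diff)

lemma h_real: "0 < t \<Longrightarrow> t < 1 \<Longrightarrow> h (of_real t) = beta_weight a b t *\<^sub>R cis (x * t)"
proof -
  assume t: "0 < t" "t < 1"
  have "of_real t powr of_real (a - 1) = (of_real (t powr (a - 1)) :: complex)"
    using t powr_of_real[of t "a - 1"] by (simp del: of_real_diff)
  moreover have "(1 - of_real t) powr of_real (b - 1) = (of_real ((1 - t) powr (b - 1)) :: complex)"
    using t powr_of_real[of "1 - t" "b - 1"] by simp
  ultimately show ?thesis
    using t by (simp add: h_def beta_weight_def scaleR_conv_of_real cis_conv_exp mult_ac del: of_real_diff)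
qed

lemma bottom_lim:
  "(\<lambda>n. LINT t|lborel. indicator {e n..1 - e n} t *\<^sub>R h (of_real t)) \<longlonglongrightarrow> beta_fourier a b x"
  unfolding beta_fourier_def
proof (rule integral_dominated_convergence[where w = "beta_weight a b"])
  have eq: "indicator {e n..1 - e n} t *\<^sub>R h (of_real t) = indicator {e n..1 - e n} t *\<^sub>R (beta_weight a b t *\<^sub>R cis (x * t))" for n t
    using h_real[of t] e[of n] by (auto simp: indicator_def)
  show "(\<lambda>t. indicator {e n..1 - e n} t *\<^sub>R h (of_real t)) \<in> borel_measurable lborel" for n
    unfolding eq by measurable
  show "AE t in lborel. norm (indicator {e n..1 - e n} t *\<^sub>R h (of_real t)) \<le> beta_weight a b t" for n
    unfolding eq by (auto simp: indicator_def)
  show "AE t in lborel. (\<lambda>n. indicator {e n..1 - e n} t *\<^sub>R h (of_real t)) \<longlonglongrightarrow> beta_weight a b t *\<^sub>R cis (x * t)"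
  proof (rule AE_I2)
    fix t :: real
    show "(\<lambda>n. indicator {e n..1 - e n} t *\<^sub>R h (of_real t)) \<longlonglongrightarrow> beta_weight a b t *\<^sub>R cis (x * t)"
    proof (cases "0 < t \<and> t < 1")
      case True
      then have "eventually (\<lambda>n. e n < min t (1 - t)) sequentially"
        using order_tendstoD(2)[OF e_lim, of "min t (1 - t)"] by auto
      then have "eventually (\<lambda>n. indicator {e n..1 - e n} t *\<^sub>R h (of_real t) = beta_weight a b t *\<^sub>R cis (x * t)) sequentially"
        by eventually_elim (use True in \<open>auto simp: h_real indicator_def\<close>)
      then show ?thesis by (rule tendsto_eventually)
    qed (simp add: eq beta_weight_eq_0)
  qed
qed (use integrable_beta_weight[OF a b] in auto)

text \<open>On the top side |z| and |1 - z| lie between 1 and 1 + R n, so both powers are bounded by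
  powers of 1 + R n with the absolute exponents, and e^(-x R n) outweighs them.\<close>

lemma top_lim:
  "(\<lambda>n. LINT t|lborel. indicator {e n..1 - e n} t *\<^sub>R h (of_real (R n) * \<i> + of_real t)) \<longlonglongrightarrow> 0"
proof -
  obtain A where A: "A \<ge> 0" "\<And>u. u \<ge> 0 \<Longrightarrow> (1 + u) powr \<bar>a - 1\<bar> \<le> A * exp (x/4 * u)"
    using powr_le_exp_bound[of "x/4" "\<bar>a - 1\<bar>"] x by auto
  obtain B where B: "B \<ge> 0" "\<And>u. u \<ge> 0 \<Longrightarrow> (1 + u) powr \<bar>b - 1\<bar> \<le> B * exp (x/4 * u)"
    using powr_le_exp_bound[of "x/4" "\<bar>b - 1\<bar>"] x by auto
  have bd: "norm (h (of_real (R n) * \<i> + of_real t)) \<le> A * B * exp (- (x/2) * R n)"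
    if t: "0 \<le> t" "t \<le> 1" for t n
  proof -
    let ?z = "of_real (R n) * \<i> + of_real t :: complex"
    have Rn: "R n \<ge> 3" by (rule R)
    have im: "Im ?z = R n" "Im (1 - ?z) = - R n" by simp_all
    have n1: "1 \<le> norm ?z" "1 \<le> norm (1 - ?z)"
      using abs_Im_le_cmod[of ?z] abs_Im_le_cmod[of "1 - ?z"] Rn unfolding im by linarith+
    have n2: "norm ?z \<le> 1 + R n" "norm (1 - ?z) \<le> 1 + R n"
      using cmod_le[of ?z] cmod_le[of "1 - ?z"] t Rn by simp_all
    have *: "r powr q \<le> (1 + R n) powr \<bar>q\<bar>" if "1 \<le> r" "r \<le> 1 + R n" for r q :: real
      using that by (intro order_trans[OF powr_mono powr_mono2]) auto
    have "norm (h ?z) = norm ?z powr (a - 1) * norm (1 - ?z) powr (b - 1) * exp (- x * Im ?z)"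
      by (rule norm_h) (use n1 in auto)
    also have "\<dots> \<le> (A * exp (x/4 * R n)) * (B * exp (x/4 * R n)) * exp (- x * R n)"
      unfolding im using n1 n2 Rn A(1) B(1)
      by (intro mult_right_mono mult_mono order_trans[OF * A(2)] order_trans[OF * B(2)]) auto
    also have "\<dots> = A * B * (exp (x/4 * R n) * exp (x/4 * R n) * exp (- x * R n))" by simp
    also have "exp (x/4 * R n) * exp (x/4 * R n) * exp (- x * R n) = exp (- (x/2) * R n)"
      by (simp add: exp_add[symmetric])
    finally show ?thesis .
  qed
  have "((\<lambda>n. A * B * exp (- (x/2) * R n)) \<longlongrightarrow> A * B * 0) sequentially"
    unfolding R_def using x by (intro tendsto_intros) real_asymp
  then have lim: "(\<lambda>n. A * B * exp (- (x/2) * R n)) \<longlonglongrightarrow> 0" by simp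
  show ?thesis
  proof (rule Lim_null_comparison[OF always_eventually lim], rule allI)
    fix n
    have "norm (LINT t|lborel. indicator {e n..1 - e n} t *\<^sub>R h (of_real (R n) * \<i> + of_real t)) \<le>
      (LINT t|lborel. indicator {0..1::real} t * (A * B * exp (- (x/2) * R n)))"
    proof (rule Bochner_Integration.integral_norm_bound_integral)
      show "integrable lborel (\<lambda>t. indicator {e n..1 - e n} t *\<^sub>R h (of_real (R n) * \<i> + of_real t))"
      proof -
        have "set_integrable lborel {e n..1 - e n} (\<lambda>t. h (of_real (R n) * \<i> + of_real t))"
          by (intro borel_integrable_atLeastAtMost' continuous_on_compose2[OF h_continuous] continuous_intros)
             (use e[of n] in \<open>auto simp: strip_def\<close>)
        then show ?thesis by (simp add: set_integrable_def)
      qed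
      show "integrable lborel (\<lambda>t. indicator {0..1::real} t * (A * B * exp (- (x/2) * R n)))"
        by simp
      show "norm (indicator {e n..1 - e n} t *\<^sub>R h (of_real (R n) * \<i> + of_real t)) \<le>
         indicator {0..1::real} t * (A * B * exp (- (x/2) * R n))" for t
        using bd[of t n] e[of n] A(1) B(1) by (auto simp: indicator_def)
    qed
    also have "\<dots> = A * B * exp (- (x/2) * R n)" by simp
    finally show "norm (LINT t|lborel. indicator {e n..1 - e n} t *\<^sub>R h (of_real (R n) * \<i> + of_real t)) \<le> \<dots>" .
  qed
qed

text \<open>Serves both vertical sides, with c0 = 0 and c0 = 1. The point u = 0, where the limit
  integrand may be singular, is discarded as a null set.\<close>

lemma side_lim:
  assumes c: "\<And>n. 0 < c n" "\<And>n. c n < 1" "c \<longlonglongrightarrow> c0"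
    and D: "integrable lborel D"
    and bd: "\<And>n u. 0 < u \<Longrightarrow> norm (h (of_real (c n) + of_real u * \<i>)) \<le> D u"
  shows "integrable lborel (\<lambda>u. if 0 < u then \<i> * h (of_real c0 + of_real u * \<i>) else 0)" (is "integrable _ ?f")
    and "(\<lambda>n. LINT u|lborel. indicator {0..R n} u *\<^sub>R (\<i> * h (of_real (c n) + of_real u * \<i>))) \<longlonglongrightarrow>
      (LINT u|lborel. (if 0 < u then \<i> * h (of_real c0 + of_real u * \<i>) else 0))"
proof -
  let ?s = "\<lambda>n u. indicator {0..R n} u *\<^sub>R (\<i> * h (of_real (c n) + of_real u * \<i>))"
  have ne: "AE u in lborel. u \<noteq> (0::real)" by (rule AE_lborel_singleton)
  have 1: "?s n \<in> borel_measurable lborel" for n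
  proof -
    have "set_integrable lborel {0..R n} (\<lambda>u. \<i> * h (of_real (c n) + of_real u * \<i>))"
      by (intro borel_integrable_atLeastAtMost' continuous_intros continuous_on_compose2[OF h_continuous])
         (use c in \<open>auto simp: strip_def\<close>)
    then show ?thesis unfolding set_integrable_def by (rule borel_measurable_integrable)
  qed
  have 2: "(\<lambda>n. ?s n u) \<longlonglongrightarrow> ?f u" if "u \<noteq> 0" for u
  proof (cases "u > 0")
    case True
    have "eventually (\<lambda>n. u < R n) sequentially" using R_lim by (simp add: filterlim_at_top_dense)
    then have ev: "eventually (\<lambda>n. \<i> * h (of_real (c n) + of_real u * \<i>) = ?s n u) sequentially"
      by eventually_elim (use True in auto)
    have "(\<lambda>n. h (of_real (c n) + of_real u * \<i>)) \<longlonglongrightarrow> h (of_real c0 + of_real u * \<i>)"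
      by (intro isCont_tendsto_compose[OF h_isCont] tendsto_intros c) (use True in simp)
    then have "(\<lambda>n. \<i> * h (of_real (c n) + of_real u * \<i>)) \<longlonglongrightarrow> ?f u"
      using True by (auto intro: tendsto_intros)
    then show ?thesis by (rule Lim_transform_eventually[OF _ ev])
  qed (use that in auto)
  have 3: "norm (?s n u) \<le> norm (D u)" if "u \<noteq> 0" for n u
    using bd[of u n] that by (auto simp: indicator_def norm_mult)
  have meas: "?f \<in> borel_measurable lborel"
  proof -
    have "continuous_on {0<..} (\<lambda>u. \<i> * h (of_real c0 + of_real u * \<i>))"
      by (intro continuous_at_imp_continuous_on ballI continuous_intros isCont_o2[OF _ h_isCont]) auto
    then have "(\<lambda>u. if u \<in> {0<..} then \<i> * h (of_real c0 + of_real u * \<i>) else 0) \<in> borel_measurable borel"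
      by (intro borel_measurable_continuous_on_if) auto
    then show ?thesis by simp
  qed
  have lim: "AE u in lborel. (\<lambda>n. ?s n u) \<longlonglongrightarrow> ?f u" using ne by eventually_elim (rule 2)
  have bound: "AE u in lborel. norm (?s n u) \<le> norm (D u)" for n using ne by eventually_elim (rule 3)
  show "integrable lborel ?f"
    by (rule integrable_dominated_convergence[OF meas 1 integrable_norm[OF D] lim bound])
  show "(\<lambda>n. integral\<^sup>L lborel (?s n)) \<longlonglongrightarrow> integral\<^sup>L lborel ?f"
    by (rule integral_dominated_convergence[OF meas 1 integrable_norm[OF D] lim bound])
qed

lemma left_side:
  "integrable lborel (\<lambda>u. if 0 < u then \<i> * h (of_real 0 + of_real u * \<i>) else 0)"
  "(\<lambda>n. LINT u|lborel. indicator {0..R n} u *\<^sub>R (\<i> * h (of_real (e n) + of_real u * \<i>))) \<longlonglongrightarrow>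
      (LINT u|lborel. (if 0 < u then \<i> * h (of_real 0 + of_real u * \<i>) else 0))"
proof -
  obtain C where C: "C \<ge> 0"
    "\<And>u r s. \<lbrakk>0 < u; u \<le> r; r \<le> 1 + u; 1/2 \<le> s; s \<le> 1 + u\<rbrakk> \<Longrightarrow>
       r powr (a - 1) * s powr (b - 1) * exp (- x * u) \<le> C * (gamma_weight a (x/2) u + gamma_weight 1 (x/2) u)"
    using ray_dominated[OF x, of a b] by blast
  have D: "integrable lborel (\<lambda>u. C * (gamma_weight a (x/2) u + gamma_weight 1 (x/2) u))"
    using a x by (intro integrable_mult_right Bochner_Integration.integrable_add integrable_gamma_weight) auto
  have bd: "norm (h (of_real (e n) + of_real u * \<i>)) \<le> C * (gamma_weight a (x/2) u + gamma_weight 1 (x/2) u)"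
    if u: "0 < u" for n u
  proof -
    let ?z = "of_real (e n) + of_real u * \<i>"
    have "norm (h ?z) = norm ?z powr (a - 1) * norm (1 - ?z) powr (b - 1) * exp (- x * Im ?z)"
      by (rule norm_h) (use u in \<open>auto simp: complex_eq_iff\<close>)
    also have "\<dots> \<le> C * (gamma_weight a (x/2) u + gamma_weight 1 (x/2) u)"
      using C(2)[of u "norm ?z" "norm (1 - ?z)"] u e[of n] cmod_le[of ?z] cmod_le[of "1 - ?z"]
        abs_Im_le_cmod[of ?z] abs_Re_le_cmod[of "1 - ?z"] by simp
    finally show ?thesis .
  qed
  have e1: "e n < 1" for n using e[of n] by linarith
  show "integrable lborel (\<lambda>u. if 0 < u then \<i> * h (of_real 0 + of_real u * \<i>) else 0)"
    "(\<lambda>n. LINT u|lborel. indicator {0..R n} u *\<^sub>R (\<i> * h (of_real (e n) + of_real u * \<i>))) \<longlonglongrightarrow>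
      (LINT u|lborel. (if 0 < u then \<i> * h (of_real 0 + of_real u * \<i>) else 0))"
    using side_lim[of e 0, OF e(1) e1 e_lim D bd] by blast+
qed

lemma right_side:
  "integrable lborel (\<lambda>u. if 0 < u then \<i> * h (of_real 1 + of_real u * \<i>) else 0)"
  "(\<lambda>n. LINT u|lborel. indicator {0..R n} u *\<^sub>R (\<i> * h (of_real (1 - e n) + of_real u * \<i>))) \<longlonglongrightarrow>
      (LINT u|lborel. (if 0 < u then \<i> * h (of_real 1 + of_real u * \<i>) else 0))"
proof -
  obtain C where C: "C \<ge> 0"
    "\<And>u r s. \<lbrakk>0 < u; u \<le> r; r \<le> 1 + u; 1/2 \<le> s; s \<le> 1 + u\<rbrakk> \<Longrightarrow>
       r powr (b - 1) * s powr (a - 1) * exp (- x * u) \<le> C * (gamma_weight b (x/2) u + gamma_weight 1 (x/2) u)"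
    using ray_dominated[OF x, of b a] by blast
  have D: "integrable lborel (\<lambda>u. C * (gamma_weight b (x/2) u + gamma_weight 1 (x/2) u))"
    using b x by (intro integrable_mult_right Bochner_Integration.integrable_add integrable_gamma_weight) auto
  have bd: "norm (h (of_real (1 - e n) + of_real u * \<i>)) \<le> C * (gamma_weight b (x/2) u + gamma_weight 1 (x/2) u)"
    if u: "0 < u" for n u
  proof -
    let ?z = "of_real (1 - e n) + of_real u * \<i>"
    have "norm (h ?z) = norm ?z powr (a - 1) * norm (1 - ?z) powr (b - 1) * exp (- x * Im ?z)"
      by (rule norm_h) (use u in \<open>auto simp: complex_eq_iff\<close>)
    also have "\<dots> \<le> C * (gamma_weight b (x/2) u + gamma_weight 1 (x/2) u)"
      using C(2)[of u "norm (1 - ?z)" "norm ?z"] u e[of n] cmod_le[of ?z] cmod_le[of "1 - ?z"]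
        abs_Im_le_cmod[of "1 - ?z"] abs_Re_le_cmod[of ?z] by (simp add: mult_ac)
    finally show ?thesis .
  qed
  have e1: "0 < 1 - e n" "1 - e n < 1" for n using e[of n] by linarith+
  have lim: "(\<lambda>n. 1 - e n) \<longlonglongrightarrow> 1" using tendsto_diff[OF tendsto_const e_lim, of 1] by simp
  show "integrable lborel (\<lambda>u. if 0 < u then \<i> * h (of_real 1 + of_real u * \<i>) else 0)"
    "(\<lambda>n. LINT u|lborel. indicator {0..R n} u *\<^sub>R (\<i> * h (of_real (1 - e n) + of_real u * \<i>))) \<longlonglongrightarrow>
      (LINT u|lborel. (if 0 < u then \<i> * h (of_real 1 + of_real u * \<i>) else 0))"
    using side_lim[of "\<lambda>n. 1 - e n" 1, OF e1 lim D bd] by blast+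
qed

lemma beta_fourier_contour:
  "beta_fourier a b x = (LINT u|lborel. (if 0 < u then \<i> * h (of_real 0 + of_real u * \<i>) else 0)) -
     (LINT u|lborel. (if 0 < u then \<i> * h (of_real 1 + of_real u * \<i>) else 0))"
proof -
  have "(\<lambda>n. LINT t|lborel. indicator {e n..1 - e n} t *\<^sub>R h (of_real t)) \<longlonglongrightarrow>
     (LINT u|lborel. (if 0 < u then \<i> * h (of_real 0 + of_real u * \<i>) else 0)) + 0 -
     (LINT u|lborel. (if 0 < u then \<i> * h (of_real 1 + of_real u * \<i>) else 0))"
    unfolding rectangle by (intro tendsto_add tendsto_diff left_side right_side top_lim)
  from LIMSEQ_unique[OF bottom_lim this] show ?thesis by simp
qed

end

section \<open>Modulus and argument on the rays\<close>

text \<open>The modulus of the integrand at z = iu, where |1 - z|^2 = 1 + u^2. On the ray at 1 the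
  distances to 0 and 1 are interchanged, so the modulus there is the same function with a and b
  swapped.\<close>

definition ray_weight :: "real \<Rightarrow> real \<Rightarrow> real \<Rightarrow> real \<Rightarrow> real" where
  "ray_weight a b x u = (if 0 < u then u powr (a - 1) * (1 + u\<^sup>2) powr ((b - 1) / 2) * exp (- x * u) else 0)"

text \<open>The argument on the ray at 0: the power of z contributes pi (a - 1)/2, the factor i of
  dz another pi/2, and 1 - iu has argument - arctan u.\<close>

definition ray_angle :: "real \<Rightarrow> real \<Rightarrow> real \<Rightarrow> real" where
  "ray_angle a b u = pi * a / 2 - (b - 1) * arctan u"

lemma ray_weight_nonneg [simp]: "0 \<le> ray_weight a b x u"
  by (simp add: ray_weight_def)

lemma Ln_one_minus_ii: "Ln (1 - \<i> * of_real u) = of_real (ln (1 + u\<^sup>2) / 2) - \<i> * of_real (arctan u)"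
proof -
  have s: "sqrt (1 + u\<^sup>2) > 0" by (simp add: add_pos_nonneg)
  have "exp (of_real (ln (sqrt (1 + u\<^sup>2))) - \<i> * of_real (arctan u)) =
      exp (of_real (ln (sqrt (1 + u\<^sup>2)))) * cis (- arctan u)"
    by (simp add: cis_conv_exp exp_add[symmetric])
  also have "exp (of_real (ln (sqrt (1 + u\<^sup>2)))) = (of_real (sqrt (1 + u\<^sup>2)) :: complex)"
    using s by (simp only: exp_of_real exp_ln)
  also have "of_real (sqrt (1 + u\<^sup>2)) * cis (- arctan u) = 1 - \<i> * of_real u"
    using s by (simp add: complex_eq_iff cos_arctan sin_arctan)
  finally have "Ln (1 - \<i> * of_real u) = Ln (exp (of_real (ln (sqrt (1 + u\<^sup>2))) - \<i> * of_real (arctan u)))" by simp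
  also have "\<dots> = of_real (ln (sqrt (1 + u\<^sup>2))) - \<i> * of_real (arctan u)"
  proof (rule Ln_exp)
    have "- (pi/2) < arctan u" "arctan u < pi/2" using arctan_bounded[of u] by auto
    then have "- pi < - arctan u" "- arctan u \<le> pi" using pi_gt_zero by linarith+
    then show "- pi < Im (of_real (ln (sqrt (1 + u\<^sup>2))) - \<i> * of_real (arctan u))"
      "Im (of_real (ln (sqrt (1 + u\<^sup>2))) - \<i> * of_real (arctan u)) \<le> pi" by simp_all
  qed
  also have "ln (sqrt (1 + u\<^sup>2)) = ln (1 + u\<^sup>2) / 2"
    by (rule ln_sqrt) (simp add: add_pos_nonneg)
  finally show ?thesis .
qed

context beta_contour
begin

lemma left_ray:
  assumes u: "u > 0"
  shows "\<i> * h (of_real 0 + of_real u * \<i>) = of_real (ray_weight a b x u) * cis (ray_angle a b u)"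
proof -
  have 1: "(of_real u * \<i>) powr of_real (a - 1) = exp (of_real (a - 1) * (of_real (ln u) + \<i> * of_real pi / 2))"
    using u by (simp add: powr_def Ln_times_of_real Ln_of_real)
  have "1 - of_real u * \<i> \<noteq> 0" by (simp add: complex_eq_iff)
  then have 2: "(1 - of_real u * \<i>) powr of_real (b - 1) =
      exp (of_real (b - 1) * (of_real (ln (1 + u\<^sup>2) / 2) - \<i> * of_real (arctan u)))"
    using Ln_one_minus_ii[of u] by (simp add: powr_def mult.commute del: of_real_divide)
  have 3: "ray_weight a b x u = exp ((a - 1) * ln u + (b - 1) / 2 * ln (1 + u\<^sup>2) + - x * u)"
  proof -
    have "1 + u\<^sup>2 \<noteq> 0" using zero_le_power2[of u] by linarith
    then show ?thesis using u by (simp add: ray_weight_def powr_def exp_add[symmetric])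
  qed
  have 4: "\<i> = exp (\<i> * of_real pi / 2)"
    using cis_conv_exp[of "pi/2"] by simp
  have 5: "\<i> * of_real x * (of_real u * \<i>) = of_real (- x * u)"
    by (simp add: complex_eq_iff)
  have "\<i> * h (of_real 0 + of_real u * \<i>) = exp (\<i> * of_real pi / 2) *
      (exp (of_real (a - 1) * (of_real (ln u) + \<i> * of_real pi / 2)) *
       exp (of_real (b - 1) * (of_real (ln (1 + u\<^sup>2) / 2) - \<i> * of_real (arctan u))) *
       exp (of_real (- x * u)))"
    unfolding h_def of_real_0 add_0 1 2 4[symmetric] 5 by (simp add: mult.commute)
  also have "\<dots> = exp (of_real ((a - 1) * ln u + (b - 1) / 2 * ln (1 + u\<^sup>2) + - x * u) + \<i> * of_real (ray_angle a b u))"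
    by (simp add: exp_add[symmetric] ray_angle_def field_simps)
  also have "\<dots> = of_real (ray_weight a b x u) * cis (ray_angle a b u)"
    unfolding 3 exp_add[of "of_real _" "\<i> * _"] exp_of_real cis_conv_exp ..
  finally show ?thesis .
qed

lemma right_ray:
  assumes u: "u > 0"
  shows "norm (\<i> * h (of_real 1 + of_real u * \<i>)) = ray_weight b a x u"
proof -
  have s: "sqrt (1 + u\<^sup>2) powr (a - 1) = (1 + u\<^sup>2) powr ((a - 1) / 2)"
    by (simp add: powr_half_sqrt[symmetric] powr_powr)
  have "norm (h (of_real 1 + of_real u * \<i>)) = norm (of_real 1 + of_real u * \<i>) powr (a - 1) *
     norm (1 - (of_real 1 + of_real u * \<i>)) powr (b - 1) * exp (- x * Im (of_real 1 + of_real u * \<i>))"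
    by (rule norm_h) (use u in \<open>auto simp: complex_eq_iff\<close>)
  moreover have "norm (of_real 1 + of_real u * \<i>) = sqrt (1 + u\<^sup>2)" by (simp add: cmod_def)
  moreover have "norm (1 - (of_real 1 + of_real u * \<i>)) = u" using u by (simp add: norm_mult)
  ultimately show ?thesis using u by (simp add: norm_mult ray_weight_def s)
qed

lemma integrable_ray: "integrable lborel (ray_weight a b x)"
proof -
  have "norm (if 0 < u then \<i> * h (of_real 0 + of_real u * \<i>) else 0) = ray_weight a b x u" for u
    using left_ray[of u] by (auto simp: norm_mult ray_weight_def)
  then show ?thesis using integrable_norm[OF left_side(1)] by simp
qed

lemma integrable_ray': "integrable lborel (ray_weight b a x)"
proof -
  have "norm (if 0 < u then \<i> * h (of_real 1 + of_real u * \<i>) else 0) = ray_weight b a x u" for u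
    using right_ray[of u] by (auto simp: ray_weight_def)
  then show ?thesis using integrable_norm[OF right_side(1)] by simp
qed

lemma ray_angle_measurable [measurable]: "ray_angle a b \<in> borel_measurable borel"
  unfolding ray_angle_def [abs_def] by measurable

lemma right_le: "norm (LINT u|lborel. (if 0 < u then \<i> * h (of_real 1 + of_real u * \<i>) else 0)) \<le> integral\<^sup>L lborel (ray_weight b a x)"
  by (rule Bochner_Integration.integral_norm_bound_integral[OF right_side(1) integrable_ray'])
     (use right_ray in \<open>auto simp del: of_real_1\<close>)

lemma left_eq: "(if 0 < u then \<i> * h (of_real 0 + of_real u * \<i>) else 0) = of_real (ray_weight a b x u) * cis (ray_angle a b u)"
  using left_ray[of u] by (auto simp: ray_weight_def)

lemma integrable_ray_trig:
  "integrable lborel (\<lambda>u. ray_weight a b x u * cos (ray_angle a b u))"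
  "integrable lborel (\<lambda>u. ray_weight a b x u * sin (ray_angle a b u))"
  using integrable_Re[OF left_side(1)[unfolded left_eq]] integrable_Im[OF left_side(1)[unfolded left_eq]] by simp_all

lemma Re_Im_left:
  "Re (LINT u|lborel. (if 0 < u then \<i> * h (of_real 0 + of_real u * \<i>) else 0)) =
     (LINT u|lborel. ray_weight a b x u * cos (ray_angle a b u))"
  "Im (LINT u|lborel. (if 0 < u then \<i> * h (of_real 0 + of_real u * \<i>) else 0)) =
     (LINT u|lborel. ray_weight a b x u * sin (ray_angle a b u))"
  using integral_Re[OF left_side(1)] integral_Im[OF left_side(1)] unfolding left_eq by simp_all

text \<open>Kept as a single integral over u, so that the main term and the bound for the other ray
  can be compared pointwise before integrating.\<close>

lemma Re_beta_fourier_ge: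
  "(LINT u|lborel. ray_weight a b x u * cos (ray_angle a b u) - ray_weight b a x u) \<le> Re (beta_fourier a b x)"
proof -
  have "(LINT u|lborel. ray_weight a b x u * cos (ray_angle a b u) - ray_weight b a x u) =
    (LINT u|lborel. ray_weight a b x u * cos (ray_angle a b u)) - integral\<^sup>L lborel (ray_weight b a x)"
    by (rule Bochner_Integration.integral_diff[OF integrable_ray_trig(1) integrable_ray'])
  then show ?thesis unfolding beta_fourier_contour
    using right_le complex_Re_le_cmod[of "LINT u|lborel. (if 0 < u then \<i> * h (of_real 1 + of_real u * \<i>) else 0)"]
      Re_Im_left(1) unfolding minus_complex.sel by linarith
qed

lemma Im_beta_fourier_ge:
  "(LINT u|lborel. ray_weight a b x u * sin (ray_angle a b u) - ray_weight b a x u) \<le> Im (beta_fourier a b x)"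
proof -
  have "(LINT u|lborel. ray_weight a b x u * sin (ray_angle a b u) - ray_weight b a x u) =
    (LINT u|lborel. ray_weight a b x u * sin (ray_angle a b u)) - integral\<^sup>L lborel (ray_weight b a x)"
    by (rule Bochner_Integration.integral_diff[OF integrable_ray_trig(2) integrable_ray'])
  then show ?thesis unfolding beta_fourier_contour
    using right_le abs_Im_le_cmod[of "LINT u|lborel. (if 0 < u then \<i> * h (of_real 1 + of_real u * \<i>) else 0)"]
      Re_Im_left(2) unfolding minus_complex.sel by linarith
qed

end

section \<open>Power series and fractional integration\<close>

lemma Beta_add_nat_le:
  assumes "a > 0" "b > 0"
  shows "Beta (a + real n) b \<le> (Beta a b :: real)"
proof -
  have "integral\<^sup>L lborel (beta_weight (a + real n) b) \<le> integral\<^sup>L lborel (beta_weight a b)"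
  proof (intro integral_mono integrable_beta_weight)
    show "beta_weight (a + real n) b t \<le> beta_weight a b t" for t
      using mult_right_mono[of "t ^ n" 1 "beta_weight a b t"]
      by (cases "0 < t \<and> t < 1") (auto simp: beta_weight_shift_power[symmetric] power_le_one beta_weight_eq_0)
  qed (use assms in auto)
  then show ?thesis using assms by (simp add: integral_beta_weight)
qed

text \<open>Termwise integration, dominated by the coefficients times \<open>Beta a b\<close>. It is
  applied twice: to the exponential series, which yields the series of K a b, and then to that
  series, which yields the fractional integral.\<close>

lemma beta_weight_power_series:
  fixes c :: "nat \<Rightarrow> complex"
  assumes a: "a > 0" and b: "b > 0" and c: "summable (\<lambda>n. norm (c n))"
    and h: "\<And>t. 0 < t \<Longrightarrow> t < 1 \<Longrightarrow> (\<lambda>n. c n * of_real t ^ n) sums h t"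
  shows "(\<lambda>n. c n * of_real (Beta (a + real n) b)) sums (LINT t|lborel. beta_weight a b t *\<^sub>R h t)"
proof -
  define f where "f n t = c n * of_real (beta_weight (a + real n) b t)" for n t
  have f: "f n t = beta_weight a b t *\<^sub>R (c n * of_real t ^ n)" for n t
    by (simp add: f_def beta_weight_shift_power[symmetric] scaleR_conv_of_real)
  have pos: "a + real n > 0" for n using a by simp
  have int: "integrable lborel (f n)" for n
    unfolding f_def using integrable_beta_weight[OF pos b] by simp
  have norm_f: "norm (f n t) = norm (c n) * beta_weight (a + real n) b t" for n t
    by (simp add: f_def norm_mult)
  have Bnn: "0 \<le> Beta (a + real n) b" for n
    using Beta_real_pos[OF pos b] by (rule less_imp_le)
  have "(\<lambda>n. integral\<^sup>L lborel (f n)) sums (LINT t|lborel. (\<Sum>n. f n t))"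
  proof (rule sums_integral[OF int])
    show "AE t in lborel. summable (\<lambda>n. norm (f n t))"
    proof (rule AE_I2)
      fix t :: real
      have "norm (norm (f n t)) \<le> norm (c n) * beta_weight a b t" for n
      proof (cases "0 < t \<and> t < 1")
        case True
        then have "norm (c n) * t ^ n * beta_weight a b t \<le> norm (c n) * 1 * beta_weight a b t"
          by (intro mult_right_mono mult_left_mono) (auto simp: power_le_one)
        moreover have "norm (norm (f n t)) = norm (f n t)" by simp
        ultimately show ?thesis unfolding norm_f by (simp add: beta_weight_shift_power[symmetric] mult.assoc)
      qed (simp add: norm_f beta_weight_eq_0)
      then show "summable (\<lambda>n. norm (f n t))"
        by (rule summable_comparison_test'[OF summable_mult2[OF c], of 0])
    qed
    show "summable (\<lambda>n. LINT t|lborel. norm (f n t))"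
    proof (rule summable_comparison_test'[OF summable_mult2[OF c, of "Beta a b"], of 0])
      show "norm (LINT t|lborel. norm (f n t)) \<le> norm (c n) * Beta a b" for n
        unfolding norm_f using Bnn[of n] Beta_add_nat_le[OF a b, of n] integrable_beta_weight[OF pos b]
        by (simp add: integral_beta_weight[OF pos b] abs_mult mult_left_mono)
    qed
  qed
  moreover have "integral\<^sup>L lborel (f n) = c n * of_real (Beta (a + real n) b)" for n
    unfolding f_def using integrable_beta_weight[OF pos b]
    by (simp add: integral_beta_weight[OF pos b])
  moreover have "(\<Sum>n. f n t) = beta_weight a b t *\<^sub>R h t" for t
  proof (cases "0 < t \<and> t < 1")
    case True
    then have "(\<lambda>n. beta_weight a b t *\<^sub>R (c n * of_real t ^ n)) sums (beta_weight a b t *\<^sub>R h t)"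
      by (intro sums_scaleR_right h) auto
    then show ?thesis unfolding f by (simp add: sums_iff)
  qed (simp add: f beta_weight_eq_0)
  ultimately show ?thesis by simp
qed

lemma beta_fourier_sums:
  assumes "a > 0" "b > 0"
  shows "(\<lambda>n. (\<i> * of_real x) ^ n / fact n * of_real (Beta (a + real n) b)) sums beta_fourier a b x"
  unfolding beta_fourier_def
proof (rule beta_weight_power_series[OF assms])
  have "summable (\<lambda>n. norm ((\<i> * of_real x) ^ n /\<^sub>R fact n))" by (rule summable_norm_exp)
  then show "summable (\<lambda>n. norm ((\<i> * of_real x) ^ n / fact n))"
    by (simp add: scaleR_conv_of_real divide_inverse mult.commute)
  show "(\<lambda>n. (\<i> * of_real x) ^ n / fact n * of_real t ^ n) sums cis (x * t)" for t
    using exp_converges[of "\<i> * of_real (x * t)"]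
    by (simp add: cis_conv_exp scaleR_conv_of_real divide_inverse power_mult_distrib mult_ac)
qed

text \<open>Comparing power series in \<open>x\<close> replaces Fubini on the triangle.\<close>

lemma beta_fourier_fractional_integral:
  assumes a: "a > 0" and b: "b > 0" and d: "d > 0"
  shows "(LINT s|lborel. beta_weight (a + b) d s *\<^sub>R beta_fourier a b (x * s)) =
    of_real (Beta b d) * beta_fourier a (b + d) x"
proof -
  define c where "c n = (\<i> * of_real x) ^ n / fact n * of_real (Beta (a + real n) b)" for n
  have sm: "summable (\<lambda>n. norm (c n))"
  proof -
    have "norm ((\<i> * of_real x) ^ n / fact n * of_real (Beta (a + real n) b)) \<le> \<bar>x\<bar> ^ n /\<^sub>R fact n * Beta a b" for n
    proof -
      have B: "\<bar>Beta (a + real n) b\<bar> \<le> Beta a b"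
        using a b Beta_add_nat_le[OF a b] Beta_real_pos[of "a + real n" b] by simp
      have "norm ((\<i> * of_real x) ^ n / fact n * of_real (Beta (a + real n) b)) = \<bar>x\<bar> ^ n / fact n * \<bar>Beta (a + real n) b\<bar>"
        by (simp add: norm_mult norm_divide norm_power)
      also have "\<dots> \<le> \<bar>x\<bar> ^ n / fact n * Beta a b"
        by (rule mult_left_mono[OF B]) simp
      also have "\<dots> = \<bar>x\<bar> ^ n /\<^sub>R fact n * Beta a b"
        by (simp add: divide_inverse mult.commute)
      finally show ?thesis .
    qed
    moreover have "summable (\<lambda>n. \<bar>x\<bar> ^ n /\<^sub>R fact n * Beta a b)"
      by (intro summable_mult2 summable_exp_generic)
    ultimately show ?thesis
      using summable_comparison_test'[of "\<lambda>n. \<bar>x\<bar> ^ n /\<^sub>R fact n * Beta a b" 0 "\<lambda>n. norm (c n)"]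
      by (simp only: c_def real_norm_def abs_norm_cancel)
  qed
  have "(\<lambda>n. c n * of_real (Beta (a + b + real n) d)) sums
      (LINT s|lborel. beta_weight (a + b) d s *\<^sub>R beta_fourier a b (x * s))"
  proof (rule beta_weight_power_series[OF _ d sm])
    show "(\<lambda>n. c n * of_real s ^ n) sums beta_fourier a b (x * s)" for s
      using beta_fourier_sums[OF a b, of "x * s"]
      by (simp add: c_def power_mult_distrib mult_ac)
  qed (use a b in simp)
  moreover have "c n * of_real (Beta (a + b + real n) d) =
     of_real (Beta b d) * ((\<i> * of_real x) ^ n / fact n * of_real (Beta (a + real n) (b + d)))" for n
  proof -
    have "Gamma (a + real n + b) > 0" "Gamma (b + d) > 0" using a b d by (auto intro!: Gamma_real_pos)
    \<comment> \<open>Gamma (a + b + n) cancels between the two Beta values; this is the fractional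
      integral read off coefficient by coefficient.\<close>
    then have "Beta (a + real n) b * Beta (a + b + real n) d = Beta b d * Beta (a + real n) (b + d)"
      by (simp add: Beta_def add_ac)
    then show ?thesis unfolding c_def by (simp flip: of_real_mult add: mult.assoc mult.left_commute)
  qed
  moreover have "(\<lambda>n. of_real (Beta b d) * ((\<i> * of_real x) ^ n / fact n * of_real (Beta (a + real n) (b + d)))) sums
     (of_real (Beta b d) * beta_fourier a (b + d) x)"
    by (intro sums_mult beta_fourier_sums) (use a b d in auto)
  ultimately show ?thesis by (auto dest: sums_unique2)
qed

lemma continuous_beta_fourier:
  assumes "a > 0" "b > 0" shows "continuous_on S (beta_fourier a b)"
  using has_vector_derivative_beta_fourier[OF assms]
  by (intro continuous_on_vector_derivative[of _ _ "\<lambda>x. \<i> * beta_fourier (a + 1) b x"])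
     (auto intro: has_vector_derivative_at_within)

lemma norm_beta_fourier_le:
  assumes "a > 0" "b > 0" shows "norm (beta_fourier a b x) \<le> Beta a b"
proof -
  have "norm (beta_fourier a b x) \<le> integral\<^sup>L lborel (beta_weight a b)"
    unfolding beta_fourier_def
    by (rule Bochner_Integration.integral_norm_bound_integral[OF integrable_beta_fourier integrable_beta_weight])
       (use assms in auto)
  then show ?thesis using assms by (simp add: integral_beta_weight)
qed

text \<open>The integral averages K a b over all arguments between 0 and x with a positive weight,
  hence always meets the range of small y where the sign is strict. \<open>L\<close> is the real or
  the imaginary part.\<close>

lemma fractional_integral_pos:
  fixes L :: "complex \<Rightarrow> real"
  assumes L: "bounded_linear L" and a: "a > 0" and b: "b > 0" and d: "b < d" and x: "x > 0"
    and nn: "\<And>y. y > 0 \<Longrightarrow> 0 \<le> L (beta_fourier a b y)"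
    and pos: "\<And>y. y > 0 \<Longrightarrow> y < y0 \<Longrightarrow> 0 < L (beta_fourier a b y)" "y0 > 0"
  shows "0 < L (beta_fourier a d x)"
proof -
  interpret L: bounded_linear L by (rule L)
  obtain K where K: "\<And>z. norm (L z) \<le> norm z * K" "K > 0" using L.pos_bounded by blast
  have db: "d - b > 0" using d by simp
  have meas [measurable]: "(\<lambda>s. beta_fourier a b (x * s)) \<in> borel_measurable borel"
    by (intro borel_measurable_continuous_onI continuous_on_compose2[OF continuous_beta_fourier[OF a b, of UNIV]] continuous_intros) auto
  have [measurable]: "L \<in> borel_measurable borel"
    by (intro borel_measurable_continuous_onI linear_continuous_on L)
  have [measurable]: "(\<lambda>s. L (beta_fourier a b (x * s))) \<in> borel_measurable borel"
    by measurable
  have "0 < (LINT s|lborel. beta_weight (a + b) (d - b) s * L (beta_fourier a b (x * s)))"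
  proof (rule integral_beta_weight_pos[where C = "Beta a b * K" and d = "y0 / x"])
    show "\<bar>L (beta_fourier a b (x * t))\<bar> \<le> Beta a b * K" for t
      using K(1)[of "beta_fourier a b (x * t)"] norm_beta_fourier_le[OF a b, of "x * t"] K(2)
      by (simp add: mult_right_mono order_trans[OF _ mult_right_mono])
    show "0 < L (beta_fourier a b (x * t))" if "0 < t" "t < y0 / x" for t
      using that x by (intro pos) (auto simp: field_simps)
  qed (use a b db x nn pos in auto)
  also have "\<dots> = L (LINT s|lborel. beta_weight (a + b) (d - b) s *\<^sub>R beta_fourier a b (x * s))"
  proof -
    have "integrable lborel (\<lambda>s. beta_weight (a + b) (d - b) s *\<^sub>R beta_fourier a b (x * s))"
      by (rule integrable_beta_weight_scaleR[where C = "Beta a b"]) (use a b db norm_beta_fourier_le in auto)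
    from integral_bounded_linear[OF L this] show ?thesis by (simp add: L.scaleR)
  qed
  also have "\<dots> = Beta b (d - b) * L (beta_fourier a d x)"
    using beta_fourier_fractional_integral[OF a b db, of x] L.scaleR[of "Beta b (d - b)" "beta_fourier a d x"]
    by (simp add: scaleR_conv_of_real)
  finally show ?thesis using Beta_real_pos[OF b db] by (simp add: zero_less_mult_iff)
qed

text \<open>For b = 1 the function t^a e^(ixt) has the boundary value e^(ix) at 1, and integrating
  its derivative gives the identity; it says that x^a K a 1 has derivative x^(a-1) e^(ix). On
  coefficients it is a/(a+n) + n/(a+n) = 1.\<close>

lemma beta_fourier_one_ode:
  assumes a: "a > 0"
  shows "of_real a * beta_fourier a 1 x + \<i> * of_real x * beta_fourier (a + 1) 1 x = cis x"
proof -
  define z where "z = \<i> * of_real x"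
  have B: "Beta c 1 = 1 / c" if "c > 0" for c :: real
    using that Gamma_plus1[of c] by (simp add: Beta_def add.commute Gamma_eq_zero_iff nonpos_Ints_def) 
  have 1: "(\<lambda>n. of_real a * (z ^ n / fact n * of_real (1 / (a + real n)))) sums (of_real a * beta_fourier a 1 x)"
    using sums_mult[OF beta_fourier_sums[OF a, of 1 x], of "of_real a"] a by (simp add: z_def B)
  define g where "g n = z ^ n / fact n * of_real (real n / (a + real n))" for n
  have "(\<lambda>n. z * (z ^ n / fact n * of_real (1 / (a + 1 + real n)))) sums (z * beta_fourier (a + 1) 1 x)"
    using sums_mult[OF beta_fourier_sums[of "a + 1" 1 x], of z] a by (simp add: z_def B)
  moreover have "z * (z ^ n / fact n * of_real (1 / (a + 1 + real n))) = g (Suc n)" for n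
  proof -
    define m where "m = (of_nat (Suc n) :: complex)"
    have m: "m \<noteq> 0" by (simp add: m_def del: of_nat_Suc)
    have "of_real (real (Suc n) / (a + real (Suc n))) = m * of_real (1 / (a + 1 + real n))"
      by (simp add: m_def add_ac)
    moreover have "fact (Suc n) = m * fact n" by (simp add: m_def)
    ultimately show ?thesis unfolding g_def using m by simp
  qed
  \<comment> \<open>\<open>g 0\<close> is 0, so shifting the index does not change the sum.\<close>
  ultimately have 2: "g sums (z * beta_fourier (a + 1) 1 x)"
    using sums_Suc[of g] by (simp add: g_def)
  have 3: "of_real a * (z ^ n / fact n * of_real (1 / (a + real n))) + g n = z ^ n /\<^sub>R fact n" for n
  proof -
    have "a + real n > 0" using a by simp
    then have "a / (a + real n) + real n / (a + real n) = 1" by (simp add: add_divide_distrib[symmetric])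
    then have "z ^ n / fact n * of_real (a / (a + real n) + real n / (a + real n)) = z ^ n / fact n" by (simp only: of_real_1 mult_1_right)
    then show ?thesis unfolding g_def by (simp add: algebra_simps scaleR_conv_of_real divide_inverse)
  qed
  have "(\<lambda>n. z ^ n /\<^sub>R fact n) sums (of_real a * beta_fourier a 1 x + z * beta_fourier (a + 1) 1 x)"
    using sums_add[OF 1 2] unfolding 3 .
  then show ?thesis
    using exp_converges[of z] by (auto simp: z_def cis_conv_exp dest: sums_unique2)
qed

section \<open>Positivity on the boundary of the regions\<close>

lemma Gamma_plus1_pos: "0 < z \<Longrightarrow> Gamma (z + 1) = z * Gamma (z :: real)"
  by (rule Gamma_plus1) (auto elim!: nonpos_Ints_cases)

text \<open>Reflection and duplication, both at z = 1/2 - h: the first involves Gamma z * Gamma (1/2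
  + h) and the sine on the left, the second Gamma z * Gamma (1 - h) and Gamma (1 - 2h). The factor
  Gamma z cancels.\<close>

lemma Gamma_reflection_duplication:
  fixes h :: real
  assumes h: "0 \<le> h" "h < 1/2"
  shows "sin (pi * (1 - 2 * h) / 2) * Gamma (1 - 2 * h) * Gamma (1/2 + h) = 4 powr - h * sqrt pi * Gamma (1 - h)"
proof -
  define z where "z = 1/2 - h"
  have z: "z > 0" using h by (simp add: z_def)
  have r: "Gamma z * Gamma (1 - z) * sin (pi * z) = pi"
  proof -
    have "complex_of_real (Gamma z * Gamma (1 - z)) = of_real (pi / sin (pi * z))"
      using Gamma_reflection_complex[of "of_real z"]
      by (simp add: Gamma_complex_of_real[symmetric] sin_of_real[symmetric])
    then have "Gamma z * Gamma (1 - z) = pi / sin (pi * z)" by (simp only: of_real_eq_iff)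
    moreover have "sin (pi * z) > 0" using z h by (intro sin_gt_zero) (auto simp: z_def)
    ultimately show ?thesis by simp
  qed
  have d: "Gamma z * Gamma (z + 1/2) = 4 powr h * sqrt pi * Gamma (2 * z)"
  proof -
    have nn: "complex_of_real z \<notin> \<int>\<^sub>\<le>\<^sub>0" "complex_of_real z + 1/2 \<notin> \<int>\<^sub>\<le>\<^sub>0"
      using z by (auto elim!: nonpos_Ints_cases simp: complex_eq_iff)
    have "complex_of_real (Gamma z * Gamma (z + 1/2)) = of_real (exp ((1 - 2 * z) * ln 2) * sqrt pi * Gamma (2 * z))"
      using Gamma_legendre_duplication[OF nn]
      by (simp add: Gamma_complex_of_real[symmetric] exp_of_real[symmetric])
    then have "Gamma z * Gamma (z + 1/2) = exp ((1 - 2 * z) * ln 2) * sqrt pi * Gamma (2 * z)" by (simp only: of_real_eq_iff)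
    moreover have "exp ((1 - 2 * z) * ln 2) = (4 :: real) powr h"
      using ln_realpow[of 2 2] by (simp add: powr_def z_def mult.commute)
    ultimately show ?thesis by simp
  qed
  have e: "1 - z = 1/2 + h" "z + 1/2 = 1 - h" "2 * z = 1 - 2 * h" "pi * z = pi * (1 - 2 * h) / 2"
    by (simp_all add: z_def field_simps)
  define g s where "g = Gamma z" and "s = sin (pi * (1 - 2 * h) / 2)"
  have g: "g > 0" using z by (simp add: g_def Gamma_real_pos)
  have r': "g * Gamma (1/2 + h) * s = pi" using r unfolding e g_def s_def .
  have d': "g * Gamma (1 - h) = 4 powr h * sqrt pi * Gamma (1 - 2 * h)" using d unfolding e g_def .
  have "g * (4 powr h * sqrt pi) * (s * Gamma (1 - 2 * h) * Gamma (1/2 + h)) =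
    (g * Gamma (1/2 + h) * s) * (4 powr h * sqrt pi * Gamma (1 - 2 * h))" by (simp add: mult_ac)
  also have "\<dots> = pi * (g * Gamma (1 - h))" unfolding r' d' ..
  also have "\<dots> = g * (4 powr h * sqrt pi) * (4 powr - h * sqrt pi * Gamma (1 - h))"
  proof -
    have "g * (4 powr h * sqrt pi) * (4 powr - h * sqrt pi * Gamma (1 - h)) =
      (sqrt pi * sqrt pi) * (4 powr h * 4 powr - h) * (g * Gamma (1 - h))" by (simp only: mult_ac)
    moreover have "sqrt pi * sqrt pi = pi" "4 powr h * 4 powr - h = (1 :: real)"
      by (simp_all add: powr_minus)
    ultimately show ?thesis by (simp only: mult_1_right)
  qed
  finally have "s * Gamma (1 - 2 * h) * Gamma (1/2 + h) = 4 powr - h * sqrt pi * Gamma (1 - h)"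
    using g by (subst (asm) mult_left_cancel) auto
  then show ?thesis by (simp add: s_def)
qed

lemma ln_Gamma_convex:
  fixes s t u :: real
  assumes "0 < s" "0 < t" "0 \<le> u" "u \<le> 1"
  shows "ln (Gamma ((1 - u) * s + u * t)) \<le> (1 - u) * ln (Gamma s) + u * ln (Gamma t)"
  using convex_onD[OF log_convex_Gamma_real, of u s t] assms by simp

text \<open>Log-convexity between 1/2 and 1, where Gamma is sqrt pi and 1; the bound is exact at
  both ends.\<close>

lemma Gamma_half_add_le:
  fixes h :: real
  assumes h: "0 \<le> h" "h \<le> 1/2"
  shows "Gamma (1/2 + h) \<le> sqrt pi * pi powr - h"
proof -
  have "ln (Gamma ((1 - 2 * h) * (1/2) + 2 * h * 1)) \<le> (1 - 2 * h) * ln (Gamma (1/2)) + 2 * h * ln (Gamma 1)"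
    by (rule ln_Gamma_convex) (use h in auto)
  also have "\<dots> = (1/2 - h) * ln pi" by (simp add: Gamma_one_half_real ln_sqrt field_simps)
  also have "(1 - 2 * h) * (1/2) + 2 * h * 1 = 1/2 + h" by (simp add: field_simps)
  finally have "exp (ln (Gamma (1/2 + h))) \<le> exp ((1/2 - h) * ln pi)" by simp
  also have "exp (ln (Gamma (1/2 + h))) = Gamma (1/2 + h)" using h by (simp add: Gamma_real_pos)
  also have "exp ((1/2 - h) * ln pi) = pi powr (1/2 + - h)" by (simp add: powr_def)
  also have "\<dots> = sqrt pi * pi powr - h" unfolding powr_add by (simp add: powr_half_sqrt)
  finally show ?thesis .
qed

text \<open>Compares the leading coefficients of the two rays for a = 1 - 2h, b = 1 - h. It is an
  equality at h = 0, and its constant is an h-th power that merges with x^h = x^(b-a).\<close>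

lemma sin_Gamma_ge:
  fixes h :: real
  assumes h: "0 \<le> h" "h < 1/2"
  shows "(pi/4) powr h * Gamma (1 - h) \<le> sin (pi * (1 - 2 * h) / 2) * Gamma (1 - 2 * h)"
proof -
  define G where "G = Gamma (1/2 + h)"
  have G: "G > 0" "G \<le> sqrt pi * pi powr - h"
    unfolding G_def using h by (auto intro: Gamma_real_pos Gamma_half_add_le)
  have "(pi/4) powr h * Gamma (1 - h) * G \<le> (pi/4) powr h * Gamma (1 - h) * (sqrt pi * pi powr - h)"
    using G h by (intro mult_left_mono) (auto intro!: mult_nonneg_nonneg less_imp_le[OF Gamma_real_pos])
  also have "\<dots> = (pi powr h * pi powr - h) * (4 powr - h * sqrt pi * Gamma (1 - h))"
  proof -
    have "(pi/4) powr h = pi powr h * 4 powr - h" by (simp add: powr_divide powr_minus_divide)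
    then show ?thesis by (simp only: mult_ac)
  qed
  also have "\<dots> = sin (pi * (1 - 2 * h) / 2) * Gamma (1 - 2 * h) * G"
    unfolding Gamma_reflection_duplication[OF h, symmetric] G_def by (simp add: powr_minus)
  finally show ?thesis using G(1) by simp
qed

lemma powr_minus_ge_linear:
  fixes y p :: real
  assumes "0 \<le> y" "0 \<le> p" shows "1 - p * y \<le> (1 + y) powr - p"
proof -
  have "p * ln (1 + y) \<le> p * y" using assms by (intro mult_left_mono ln_add_one_self_le_self) auto
  moreover have "1 + (- (p * ln (1 + y))) \<le> exp (- (p * ln (1 + y)))" by (rule exp_ge_add_one_self)
  ultimately show ?thesis using assms by (simp add: powr_def)
qed

lemma one_add_square_powr_le_1:
  fixes u q :: real
  assumes "q \<le> 0" shows "(1 + u\<^sup>2) powr q \<le> 1"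
proof -
  have u: "1 \<le> 1 + u\<^sup>2" by simp
  then have "(1 + u\<^sup>2) powr q \<le> (1 + u\<^sup>2) powr 0" using assms by (intro powr_mono)
  also have "\<dots> = 1" using u by (metis not_one_le_zero powr_zero_eq_one)
  finally show ?thesis .
qed

lemma cos_concave:
  assumes y: "\<bar>y\<bar> \<le> pi/2" and s: "0 \<le> s" "s \<le> 1"
  shows "1 - s + s * cos y \<le> cos (s * y)"
proof -
  have "concave_on {-(pi/2)..pi/2} cos"
  proof (rule f''_le0_imp_concave)
    show "(cos has_real_derivative - sin t) (at t)" for t :: real by (auto intro!: derivative_eq_intros)
    show "((\<lambda>t. - sin t) has_real_derivative - cos t) (at t)" for t :: real by (auto intro!: derivative_eq_intros)
    show "- cos t \<le> 0" if "t \<in> {-(pi/2)..pi/2}" for t :: real using that cos_ge_zero[of t] by auto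
  qed simp
  moreover have "y \<in> {-(pi/2)..pi/2}" "0 \<in> {-(pi/2)..pi/2}" using y by (auto simp: abs_le_iff)
  ultimately show ?thesis using concave_onD[of _ cos s 0 y] s by simp
qed

lemma powr_le_linear:
  fixes r s :: real
  assumes "0 < r" "0 \<le> s" "s \<le> 1" shows "r powr s \<le> 1 - s + s * r"
  using convex_onD[OF exp_convex assms(2,3), of 0 "ln r"] assms by (simp add: powr_def)

section \<open>Positivity of the imaginary part on the boundary of the larger region\<close>

text \<open>The difference of the integrands becomes negative for large u, where their quotient
  tends to cos (pi h/2) < 1, so only the integrals can be compared. Since the rays cancel at h = 0,
  a gain and a loss of order h compete: the gain is the factor (pi x/4)^h \<ge> 1 + h/2, the loss
  from the minorant at most 1 - h/9.\<close>

lemma Im_beta_fourier_pos_a_lt_1: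
  fixes h x :: real
  assumes h: "0 < h" "h < 1/2" and x: "x \<ge> pi"
  shows "0 < Im (beta_fourier (1 - 2 * h) (1 - h) x)"
proof -
  define a b where "a = 1 - 2 * h" and "b = 1 - h"
  have ab: "a > 0" "b > 0" "a \<le> 1" "a + h = b" using h by (auto simp: a_def b_def)
  have x0: "x > 0" "x \<ge> 3" using x pi_gt3 by auto
  interpret beta_contour a b x using ab x0 by unfold_locales auto
  define s where "s = sin (pi * a / 2)"
  have s: "0 \<le> s" unfolding s_def using ab by (intro sin_ge_zero) auto
  \<comment> \<open>An integrable minorant in gamma weights: the angle lies between pi a/2 and pi/2,
    so its sine is at least s; (1 + u^2)^(-h/2) is at least 1 - (h/2) u^2; and on the other ray the
    power of 1 + u^2 is at most 1.\<close>
  let ?g = "\<lambda>u. s * (gamma_weight a x u - (h/2) * gamma_weight (a + 2) x u) - gamma_weight b x u"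
  have int: "integrable lborel ?g"
    using ab x0 by (intro Bochner_Integration.integrable_diff integrable_mult_right integrable_gamma_weight) auto
  have "(LINT u|lborel. ?g u) = s * (Gamma a * x powr - a - h/2 * (Gamma (a + 2) * x powr - (a + 2))) - Gamma b * x powr - b"
    using ab x0 by (simp add: integral_gamma_weight integrable_gamma_weight)
  also have "Gamma (a + 2) = (a + 1) * a * Gamma a"
    using ab Gamma_plus1_pos[of a] Gamma_plus1_pos[of "a + 1"] by (simp add: add.assoc)
  also have "x powr - (a + 2) = x powr - a / x\<^sup>2"
    using x0 powr_diff[of x "-a" 2] by simp
  also have "s * (Gamma a * x powr - a - h/2 * ((a + 1) * a * Gamma a * (x powr - a / x\<^sup>2))) - Gamma b * x powr - b =
    s * Gamma a * x powr - a * (1 - h * ((a + 1) * a / 2) / x\<^sup>2) - Gamma b * x powr - b" by (simp add: field_simps)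
  finally have val: "(LINT u|lborel. ?g u) = \<dots>" .
  have "(a + 1) * a \<le> 2 * 1" using ab by (intro mult_mono) auto
  then have q: "h * ((a + 1) * a / 2) / x\<^sup>2 \<le> h / 9"
  proof -
    have "h * ((a + 1) * a / 2) \<le> h * 1" using h \<open>(a + 1) * a \<le> 2 * 1\<close> by (intro mult_left_mono) auto
    moreover have "x\<^sup>2 \<ge> 9" using power_mono[OF x0(2), of 2] by simp
    ultimately show ?thesis using h ab by (intro frac_le) auto
  qed
  have Gb: "Gamma b > 0" using ab by (simp add: Gamma_real_pos)
  \<comment> \<open>9/4 is the lower bound of pi x/4 obtained from pi \<ge> 3 and x \<ge> 3; its
    logarithm is at least 1 - 4/9, hence at least 1/2.\<close>
  have "1 + h * (1/2) \<le> (9/4) powr h"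
  proof -
    have "1/2 \<le> 1 - 1 / (9/4 :: real)" by simp
    also have "\<dots> \<le> ln (9/4)" using ln_le_minus_one[of "4/9"] ln_inverse[of "9/4"] by simp
    finally have "1 + h * (1/2) \<le> 1 + h * ln (9/4)" using h by simp
    also have "\<dots> \<le> exp (h * ln (9/4))" by (rule exp_ge_add_one_self)
    finally show ?thesis by (simp add: powr_def)
  qed
  also have "(9/4) powr h \<le> (pi/4 * x) powr h"
  proof (rule powr_mono2)
    have "3 * 3 \<le> pi * x" using x0 pi_gt3 by (intro mult_mono) auto
    then show "9/4 \<le> pi/4 * x" by simp
  qed (use h in auto)
  finally have e1: "1 + h/2 \<le> (pi/4 * x) powr h" by simp
  have "1 < (1 + h/2) * (1 - h/9)" using h by (simp add: algebra_simps)
  also have "\<dots> \<le> (pi/4 * x) powr h * (1 - h * ((a + 1) * a / 2) / x\<^sup>2)"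
    using e1 q h by (intro mult_mono) auto
  finally have "Gamma b * x powr - b * 1 < Gamma b * x powr - b * ((pi/4 * x) powr h * (1 - h * ((a + 1) * a / 2) / x\<^sup>2))"
    using Gb x0 by (intro mult_strict_left_mono) auto
  also have "\<dots> = (pi/4) powr h * Gamma b * (x powr h * x powr - b) * (1 - h * ((a + 1) * a / 2) / x\<^sup>2)"
    using x0 by (simp only: powr_mult) (simp add: mult_ac)
  also have "x powr h * x powr - b = x powr - a"
  proof -
    have "h + - b = - a" using ab(4) by simp
    then show ?thesis unfolding powr_add[symmetric] by simp
  qed
  also have "(pi/4) powr h * Gamma b * x powr - a * (1 - h * ((a + 1) * a / 2) / x\<^sup>2) \<le>
      s * Gamma a * x powr - a * (1 - h * ((a + 1) * a / 2) / x\<^sup>2)"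
    using sin_Gamma_ge[of h] h q by (intro mult_right_mono) (auto simp: a_def b_def s_def)
  finally have "0 < (LINT u|lborel. ?g u)" unfolding val by simp
  also have "\<dots> \<le> (LINT u|lborel. ray_weight a b x u * sin (ray_angle a b u) - ray_weight b a x u)"
  proof (rule integral_mono[OF int Bochner_Integration.integrable_diff[OF integrable_ray_trig(2) integrable_ray']])
    fix u :: real
    show "?g u \<le> ray_weight a b x u * sin (ray_angle a b u) - ray_weight b a x u"
    proof (cases "u > 0")
      case True
      define E where "E = exp (- x * u)"
      have E: "E > 0" by (simp add: E_def)
      have t: "0 \<le> arctan u" "arctan u \<le> pi/2" using True arctan_ubound[of u] by auto
      have ang: "ray_angle a b u = pi * a / 2 + h * arctan u" by (simp add: ray_angle_def b_def)
      have "h * arctan u \<le> h * (pi/2)" using h t by (intro mult_left_mono) auto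
      then have "ray_angle a b u \<le> pi * a / 2 + h * (pi/2)" unfolding ang by simp
      also have "\<dots> = pi/2 * b" unfolding ab(4)[symmetric] by (simp add: field_simps)
      also have "\<dots> \<le> pi/2 * 1" using h by (intro mult_left_mono) (auto simp: b_def)
      finally have "ray_angle a b u \<le> pi/2" by simp
      moreover have "pi * a / 2 \<le> ray_angle a b u" unfolding ang using h t by simp
      ultimately have sn: "s \<le> sin (ray_angle a b u)" unfolding s_def
        using ab by (intro sin_monotone_2pi_le) (auto intro: order_trans[of _ 0])
      have p1: "1 - h/2 * u\<^sup>2 \<le> (1 + u\<^sup>2) powr ((b - 1) / 2)"
        using powr_minus_ge_linear[of "u\<^sup>2" "h/2"] h by (simp add: b_def)
      have up: "u powr (a + 2 - 1) = u powr (a - 1) * u\<^sup>2"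
        using True powr_add[of u "a - 1" 2] by simp
      have "s * (gamma_weight a x u - (h/2) * gamma_weight (a + 2) x u) = s * (u powr (a - 1) * E * (1 - h/2 * u\<^sup>2))"
        using True unfolding gamma_weight_def up by (simp add: E_def algebra_simps)
      also have "\<dots> \<le> s * (u powr (a - 1) * E * (1 + u\<^sup>2) powr ((b - 1) / 2))"
        using s E p1 by (intro mult_left_mono) auto
      also have "\<dots> = ray_weight a b x u * s" using True by (simp add: ray_weight_def E_def mult_ac)
      also have "\<dots> \<le> ray_weight a b x u * sin (ray_angle a b u)" using sn by (intro mult_left_mono) auto
      finally have 1: "s * (gamma_weight a x u - (h/2) * gamma_weight (a + 2) x u) \<le> ray_weight a b x u * sin (ray_angle a b u)" .
      have "(1 + u\<^sup>2) powr ((a - 1) / 2) \<le> 1"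
        using ab by (intro one_add_square_powr_le_1) auto
      then have "u powr (b - 1) * (1 + u\<^sup>2) powr ((a - 1) / 2) * E \<le> u powr (b - 1) * 1 * E"
        using E by (intro mult_right_mono mult_left_mono) auto
      then have "ray_weight b a x u \<le> gamma_weight b x u"
        using True by (simp add: gamma_weight_def ray_weight_def E_def)
      with 1 show ?thesis by linarith
    qed (simp add: gamma_weight_def ray_weight_def)
  qed
  also have "\<dots> \<le> Im (beta_fourier a b x)" by (rule Im_beta_fourier_ge)
  finally show ?thesis by (simp add: a_def b_def)
qed

text \<open>After division by the common weight, sin of the angle is compared with (u/q)^h, q = sqrt
  (1 + u^2). Concavity of cos bounds the first from below, the weighted mean inequality bounds the
  second from above, both with weights 1 - h and h; the parts 1 - h cancel and h (2u/w - u/q)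
  remains, with w = q^2. It is negative for q > 2, so again an integral decides.\<close>

lemma Im_beta_fourier_pos_a_gt_1:
  fixes h x :: real
  assumes h: "0 < h" "h \<le> 1" and x: "x \<ge> pi"
  shows "0 < Im (beta_fourier (1 + h) (1 + 2 * h) x)"
proof -
  define a b where "a = 1 + h" and "b = 1 + 2 * h"
  have ab: "a > 0" "b > 0" "a \<le> 2" using h by (auto simp: a_def b_def)
  have x0: "x > 0" "x \<ge> 3" using x pi_gt3 by auto
  interpret beta_contour a b x using ab x0 by unfold_locales auto
  \<comment> \<open>The value of h w^(h-1) at w = 3, that is u^2 = 2, where 1 - u^2/2 changes
    sign.\<close>
  define K where "K = h * 3 powr (h - 1)"
  have K: "K > 0" using h by (simp add: K_def)
  let ?g = "\<lambda>u. K * (gamma_weight (a + 1) x u - 1/2 * gamma_weight (a + 3) x u)"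
  have int: "integrable lborel ?g"
    using ab x0 by (intro Bochner_Integration.integrable_diff integrable_mult_right integrable_gamma_weight) auto
  have "(LINT u|lborel. ?g u) = K * (Gamma (a + 1) * x powr - (a + 1) - 1/2 * (Gamma (a + 3) * x powr - (a + 3)))"
    using ab x0 by (simp add: integral_gamma_weight integrable_gamma_weight)
  also have "Gamma (a + 3) = (a + 2) * (a + 1) * Gamma (a + 1)"
    using ab Gamma_plus1_pos[of "a + 1"] Gamma_plus1_pos[of "a + 2"] by (simp add: add.assoc)
  also have "x powr - (a + 3) = x powr - (a + 1) / x\<^sup>2"
    using x0 powr_diff[of x "-(a + 1)" 2] by (simp add: algebra_simps)
  also have "K * (Gamma (a + 1) * x powr - (a + 1) - 1/2 * ((a + 2) * (a + 1) * Gamma (a + 1) * (x powr - (a + 1) / x\<^sup>2))) =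
     K * Gamma (a + 1) * x powr - (a + 1) * (1 - (a + 2) * (a + 1) / 2 / x\<^sup>2)" by (simp add: field_simps)
  finally have val: "(LINT u|lborel. ?g u) = \<dots>" .
  have "(a + 2) * (a + 1) \<le> 4 * 3" using ab by (intro mult_mono) auto
  then have "(a + 2) * (a + 1) / 2 / x\<^sup>2 \<le> 6 / 9"
    using power_mono[OF x0(2), of 2] ab by (intro frac_le) auto
  also have "6 / 9 < (1 :: real)" by simp
  finally have "(a + 2) * (a + 1) / 2 / x\<^sup>2 < 1" .
  then have "0 < 1 - (a + 2) * (a + 1) / 2 / x\<^sup>2" by (simp only: diff_gt_0_iff_gt)
  then have "0 < (LINT u|lborel. ?g u)" unfolding val
    using K x0 ab by (intro mult_pos_pos[OF mult_pos_pos[OF mult_pos_pos]]) (auto intro!: Gamma_real_pos)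
  also have "\<dots> \<le> (LINT u|lborel. ray_weight a b x u * sin (ray_angle a b u) - ray_weight b a x u)"
  proof (rule integral_mono[OF int Bochner_Integration.integrable_diff[OF integrable_ray_trig(2) integrable_ray']])
    fix u :: real
    show "?g u \<le> ray_weight a b x u * sin (ray_angle a b u) - ray_weight b a x u"
    proof (cases "u > 0")
      case u: True
      define E where "E = exp (- x * u)"
      define w where "w = 1 + u\<^sup>2"
      define q where "q = sqrt w"
      have E: "E > 0" by (simp add: E_def)
      have w: "w > 0" "w \<ge> 1" by (auto simp: w_def add_pos_nonneg)
      have q: "q > 0" "q * q = w" using w by (auto simp: q_def)
      have t: "0 \<le> arctan u" "arctan u \<le> pi/2" using u arctan_ubound[of u] by auto
      have sc: "sin (arctan u) = u / q" "cos (arctan u) = 1 / q"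
        by (simp_all add: sin_arctan cos_arctan q_def w_def)
      \<comment> \<open>The angle is pi/2 + h y, so its sine is cos (h y), and |y| \<le> pi/2 is the
        range where cos is concave.\<close>
      define y where "y = pi/2 - 2 * arctan u"
      have "sin (ray_angle a b u) = sin (pi/2 + h * y)"
        by (rule arg_cong[where f = sin]) (simp add: ray_angle_def a_def b_def y_def field_simps)
      also have "\<dots> = cos (h * y)" by (simp add: sin_add)
      also have "\<dots> \<ge> 1 - h + h * cos y"
      proof (rule cos_concave)
        show "\<bar>y\<bar> \<le> pi/2" unfolding y_def using t by (intro abs_leI) linarith+
      qed (use h in auto)
      also have "cos y = 2 * u / w"
        unfolding y_def cos_diff sin_double sc q(2)[symmetric] using q by (simp add: sc sin_double)
      finally have sn: "1 - h + h * (2 * u / w) \<le> sin (ray_angle a b u)" .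
      have pw: "(u / q) powr h \<le> 1 - h + h * (u / q)"
        by (rule powr_le_linear) (use u q h in auto)
      have rb: "ray_weight b a x u = ray_weight a b x u * (u / q) powr h"
      proof -
        have "(u / q) powr h = u powr h * w powr - (h/2)"
          using u w unfolding q_def by (simp add: powr_divide powr_minus_divide powr_half_sqrt[symmetric] powr_powr)
        moreover have "u powr (b - 1) = u powr (a - 1) * u powr h"
          by (simp add: powr_add[symmetric] a_def b_def)
        moreover have "w powr ((a - 1) / 2) = w powr ((b - 1) / 2) * w powr - (h/2)"
          by (simp add: powr_add[symmetric] a_def b_def field_simps)
        ultimately show ?thesis using u by (simp add: ray_weight_def w_def[symmetric] mult_ac)
      qed
      \<comment> \<open>The mean inequality for q^2 and 1 replaces the root by a polynomial in u,
        which the gamma weights can integrate.\<close>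
      have "q \<le> w / 2 + 1 / 2"
        using sum_squares_bound[of q 1] q(2) by (simp add: power2_eq_square)
      then have q2: "1 - u\<^sup>2 / 2 \<le> 2 - q" by (simp add: w_def field_simps)
      have e: "2 * u / w - u / q = u / w * (2 - q)" using q by (simp add: q(2)[symmetric] field_simps)
      have key: "h * (u / w) * (1 - u\<^sup>2 / 2) \<le> sin (ray_angle a b u) - (u / q) powr h"
      proof -
        have "h * (u / w) * (1 - u\<^sup>2 / 2) \<le> h * (u / w) * (2 - q)"
          using h u w by (intro mult_left_mono[OF q2]) auto
        also have "\<dots> = h * (2 * u / w - u / q)" unfolding e by simp
        also have "\<dots> = (1 - h + h * (2 * u / w)) - (1 - h + h * (u / q))" by (simp add: right_diff_distrib)
        also have "\<dots> \<le> sin (ray_angle a b u) - (u / q) powr h" using sn pw by linarith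
        finally show ?thesis .
      qed
      have ra: "ray_weight a b x u * (h * (u / w)) = h * (u powr h * u) * w powr (h - 1) * E"
        using u w by (simp add: ray_weight_def w_def[symmetric] a_def b_def E_def powr_diff)
      \<comment> \<open>the second factor changes sign at \<open>w = 3\<close>, where the decreasing first factors agree\<close>
      have cross: "3 powr (h - 1) * (1 - u\<^sup>2 / 2) \<le> w powr (h - 1) * (1 - u\<^sup>2 / 2)"
      proof (cases "w \<le> 3")
        case True
        then have "3 powr (h - 1) \<le> w powr (h - 1)" using w h by (intro powr_mono2') auto
        then show ?thesis using True by (intro mult_right_mono) (auto simp: w_def)
      next
        case False
        then have "w powr (h - 1) \<le> 3 powr (h - 1)" using w h by (intro powr_mono2') auto
        then show ?thesis using False by (intro mult_right_mono_neg) (auto simp: w_def)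
      qed
      have up: "u powr (a + 1 - 1) = u powr h * u" "u powr (a + 3 - 1) = u powr h * u * u\<^sup>2"
        using u powr_add[of u h 1] powr_add[of u "h + 1" 2] by (simp_all add: a_def add_ac)
      have "?g u = h * (u powr h * u) * E * (3 powr (h - 1) * (1 - u\<^sup>2 / 2))"
        using u unfolding gamma_weight_def up by (simp add: K_def E_def algebra_simps)
      also have "\<dots> \<le> h * (u powr h * u) * E * (w powr (h - 1) * (1 - u\<^sup>2 / 2))"
        using h u E by (intro mult_left_mono[OF cross]) auto
      also have "\<dots> = ray_weight a b x u * (h * (u / w) * (1 - u\<^sup>2 / 2))"
        unfolding mult.assoc[symmetric] using ra by (simp add: mult_ac)
      also have "\<dots> \<le> ray_weight a b x u * (sin (ray_angle a b u) - (u / q) powr h)"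
        by (intro mult_left_mono[OF key]) simp
      also have "\<dots> = ray_weight a b x u * sin (ray_angle a b u) - ray_weight b a x u"
        unfolding rb by (simp add: right_diff_distrib)
      finally show ?thesis .
    qed (simp add: gamma_weight_def ray_weight_def)
  qed
  also have "\<dots> \<le> Im (beta_fourier a b x)" by (rule Im_beta_fourier_ge)
  finally show ?thesis by (simp add: a_def b_def)
qed

section \<open>Positivity of the real part on the boundary of the smaller region\<close>

text \<open>For y = pi/2 - arctan u the angle is a y and the quotient of the two weights is cos y.
  Here a pointwise comparison suffices: cos (a y) \<ge> cos y. Equality for a = 1 is the excluded
  point (1,2).\<close>

lemma ray_integrand_a_plus_1:
  assumes a: "0 < a" "a \<le> 1" and u: "u > 0"
  shows "0 \<le> ray_weight a (a + 1) x u * cos (ray_angle a (a + 1) u) - ray_weight (a + 1) a x u"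
    and "a < 1 \<Longrightarrow> 0 < ray_weight a (a + 1) x u * cos (ray_angle a (a + 1) u) - ray_weight (a + 1) a x u"
proof -
  define w where "w = 1 + u\<^sup>2"
  have w: "w > 0" by (auto simp: w_def add_pos_nonneg)
  have t: "0 < arctan u" "arctan u < pi/2" using u arctan_ubound[of u] by auto
  define y where "y = pi/2 - arctan u"
  have y: "0 < y" "y \<le> pi" using t pi_gt_zero unfolding y_def by linarith+
  have ang: "ray_angle a (a + 1) u = a * y" by (simp add: ray_angle_def y_def field_simps)
  have cy: "cos y = u / sqrt w" by (simp add: y_def cos_diff sin_arctan w_def)
  have rb: "ray_weight (a + 1) a x u = ray_weight a (a + 1) x u * cos y"
  proof -
    have "u / sqrt w = u * w powr - (1/2)"
      using w by (simp add: powr_minus_divide powr_half_sqrt)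
    moreover have "u powr (a + 1 - 1) = u powr (a - 1) * u"
      using u powr_add[of u "a - 1" 1] by simp
    moreover have "w powr ((a - 1) / 2) = w powr ((a + 1 - 1) / 2) * w powr - (1/2)"
      by (simp add: powr_add[symmetric] field_simps)
    ultimately show ?thesis unfolding cy using u by (simp add: ray_weight_def w_def[symmetric] mult_ac)
  qed
  have e: "ray_weight a (a + 1) x u * cos (ray_angle a (a + 1) u) - ray_weight (a + 1) a x u =
      ray_weight a (a + 1) x u * (cos (a * y) - cos y)"
    unfolding rb ang by (simp add: right_diff_distrib)
  have pos: "ray_weight a (a + 1) x u > 0" using u w by (simp add: ray_weight_def w_def)
  have "a * y \<le> 1 * y" using a y by (intro mult_right_mono) auto
  then have "cos y \<le> cos (a * y)" using a y by (intro cos_monotone_0_pi_le) auto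
  then show "0 \<le> ray_weight a (a + 1) x u * cos (ray_angle a (a + 1) u) - ray_weight (a + 1) a x u"
    unfolding e using pos by simp
  assume "a < 1"
  then have "a * y < 1 * y" using y by (intro mult_strict_right_mono) auto
  then have "cos y < cos (a * y)" using a y by (intro cos_monotone_0_pi) auto
  then show "0 < ray_weight a (a + 1) x u * cos (ray_angle a (a + 1) u) - ray_weight (a + 1) a x u"
    unfolding e using pos by simp
qed

lemma Re_beta_fourier_a_plus_1:
  assumes a01: "0 < a" "a \<le> 1" and x: "x > 0"
  shows "0 \<le> Re (beta_fourier a (a + 1) x)" and "a < 1 \<Longrightarrow> 0 < Re (beta_fourier a (a + 1) x)"
proof -
  interpret beta_contour a "a + 1" x using a01 x by unfold_locales auto
  let ?f = "\<lambda>u. ray_weight a (a + 1) x u * cos (ray_angle a (a + 1) u) - ray_weight (a + 1) a x u"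
  have nn: "0 \<le> ?f u" for u
    using ray_integrand_a_plus_1(1)[OF a01, of u x] by (cases "u > 0") (auto simp: ray_weight_def)
  show "0 \<le> Re (beta_fourier a (a + 1) x)"
    by (rule order_trans[OF Bochner_Integration.integral_nonneg Re_beta_fourier_ge]) (rule nn)
  assume "a < 1"
  have "0 < integral\<^sup>L lborel ?f"
  proof (rule integral_lborel_pos[OF _ nn])
    show "integrable lborel ?f"
      by (rule Bochner_Integration.integrable_diff[OF integrable_ray_trig(1) integrable_ray'])
    show "0 < ?f u" if "0 < u" "u < 1" for u
      using ray_integrand_a_plus_1(2)[OF a01 that(1) \<open>a < 1\<close>] .
  qed simp
  then show "0 < Re (beta_fourier a (a + 1) x)" using Re_beta_fourier_ge by linarith
qed

text \<open>Log-convexity at \<open>1 + a\<close>, \<open>2\<close>, \<open>5/2\<close>, with \<open>\<Gamma>(2) = 1\<close> and \<open>\<Gamma>(5/2)\<^sup>2 = 9\<pi>/16\<close>.\<close>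

lemma Gamma_one_add_ge:
  fixes a :: real
  assumes a: "0 < a" "a \<le> 1"
  shows "(16 / (9 * pi)) powr (1 - a) \<le> Gamma (1 + a)"
proof -
  \<comment> \<open>The weight that places 2 on the segment from 1 + a to 5/2.\<close>
  define u where "u = (2 - 2 * a) / (3 - 2 * a)"
  have u: "0 \<le> u" "u \<le> 1" "1 - u = 1 / (3 - 2 * a)" using a by (auto simp: u_def field_simps)
  have G52: "Gamma (5/2 :: real) = 3/4 * sqrt pi"
    using Gamma_plus1_pos[of "1/2"] Gamma_plus1_pos[of "3/2"] by (simp add: Gamma_one_half_real)
  have "ln (Gamma ((1 - u) * (1 + a) + u * (5/2))) \<le> (1 - u) * ln (Gamma (1 + a)) + u * ln (Gamma (5/2))"
    by (rule ln_Gamma_convex) (use a u in auto)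
  moreover have "(1 - u) * (1 + a) + u * (5/2) = 2"
  proof -
    have "u * (3 - 2 * a) = 2 - 2 * a" using a by (simp add: u_def)
    then show ?thesis by (simp add: algebra_simps)
  qed
  moreover have "Gamma (2 :: real) = 1" using Gamma_fact[of 1, where 'a = real] by simp
  ultimately have "0 \<le> (1 - u) * ln (Gamma (1 + a)) + u * ln (Gamma (5/2))" by simp
  also have "\<dots> = (ln (Gamma (1 + a)) + (2 - 2 * a) * ln (Gamma (5/2))) / (3 - 2 * a)"
    unfolding u(3) unfolding u_def by (simp add: add_divide_distrib)
  finally have "0 \<le> ln (Gamma (1 + a)) + (2 - 2 * a) * ln (Gamma (5/2))"
    using a by (simp add: zero_le_divide_iff)
  also have "(2 - 2 * a) * ln (Gamma (5/2)) = (1 - a) * ln ((3/4 * sqrt pi)\<^sup>2)"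
    unfolding G52 by (subst ln_realpow) (simp_all add: algebra_simps)
  also have "(3/4 * sqrt pi)\<^sup>2 = inverse (16 / (9 * pi))" by (simp add: power_mult_distrib power2_eq_square)
  also have "ln (inverse (16 / (9 * pi))) = - ln (16 / (9 * pi))" by (rule ln_inverse)
  finally have "(1 - a) * ln (16 / (9 * pi)) \<le> ln (Gamma (1 + a))" by (simp add: algebra_simps)
  then have "exp ((1 - a) * ln (16 / (9 * pi))) \<le> exp (ln (Gamma (1 + a)))" by simp
  then show ?thesis using a by (simp add: powr_def Gamma_real_pos)
qed

text \<open>For b = 1 the angle is constant, so the main term is exactly cos (pi a/2) Gamma a
  x^(-a), while the other ray contributes at most 1/x. What remains is a < cos (pi a/2) Gamma (1 +
  a) x^(1-a).\<close>

lemma Re_beta_fourier_pos_b_1_large: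
  assumes a23: "0 < a" "a \<le> 2/3" and x32: "x \<ge> 3/2 * pi"
  shows "0 < Re (beta_fourier a 1 x)"
proof -
  have x0: "x > 0" using x32 pi_gt_zero by linarith
  interpret beta_contour a 1 x using a23 x0 by unfold_locales auto
  define c where "c = cos (pi * a / 2)"
  let ?g = "\<lambda>u. c * gamma_weight a x u - gamma_weight 1 x u"
  have int: "integrable lborel ?g"
    using a23 x0 by (intro Bochner_Integration.integrable_diff integrable_mult_right integrable_gamma_weight) auto
  have val: "(LINT u|lborel. ?g u) = c * (Gamma a * x powr - a) - x powr - 1"
    using a23 x0 integral_gamma_weight[of 1 x] by (simp add: integral_gamma_weight integrable_gamma_weight)
  \<comment> \<open>The chord of cos from 0 to pi/3, the angle pi a/2 at a = 2/3.\<close>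
  have c: "c \<ge> 1 - 3/4 * a"
  proof -
    have "1 - 3/2 * a + 3/2 * a * cos (pi/3) \<le> cos (3/2 * a * (pi/3))"
      by (rule cos_concave) (use a23 in auto)
    moreover have "3/2 * a * (pi/3) = pi * a / 2" by simp
    ultimately show ?thesis by (simp add: c_def cos_60)
  qed
  \<comment> \<open>8/3 is the product of 16/(9 pi) from \<open>Gamma_one_add_ge\<close> and the
    smallest x, and 1 - a \<ge> 1/3. The value 4/3 is what the chord bound requires: (1 - 3a/4) *
    4/3 \<ge> a, with equality at a = 2/3.\<close>
  have "4/3 < (8/3 :: real) powr (1/3)"
  proof (rule ccontr)
    assume "\<not> ?thesis"
    then have "((8/3 :: real) powr (1/3)) ^ 3 \<le> (4/3) ^ 3" by (intro power_mono) auto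
    moreover have "((8/3 :: real) powr (1/3)) ^ 3 = 8/3" by (simp add: powr_power)
    ultimately show False by (simp add: power3_eq_cube)
  qed
  also have "\<dots> \<le> (8/3) powr (1 - a)" using a23 by (intro powr_mono) auto
  also have "(8/3) powr (1 - a) = (16 / (9 * pi) * (3/2 * pi)) powr (1 - a)" by simp
  also have "\<dots> = (16 / (9 * pi)) powr (1 - a) * (3/2 * pi) powr (1 - a)" by (rule powr_mult)
  also have "\<dots> \<le> Gamma (1 + a) * x powr (1 - a)"
    using Gamma_one_add_ge[of a] a23 x32 by (intro mult_mono powr_mono2) auto
  finally have g: "4/3 < Gamma (1 + a) * x powr (1 - a)" .
  have "a \<le> (1 - 3/4 * a) * (4/3)" using a23 by simp
  also have "\<dots> \<le> c * (4/3)" using c by simp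
  also have "\<dots> < c * (Gamma (1 + a) * x powr (1 - a))" using c a23 by (intro mult_strict_left_mono[OF g]) linarith
  also have "\<dots> = a * (c * (Gamma a * x powr - a) * x)"
    using a23 x0 Gamma_plus1_pos[of a] powr_add[of x "-a" 1] by (simp add: add.commute mult_ac)
  finally have "1 < c * (Gamma a * x powr - a) * x" using a23 by simp
  then have "x powr - 1 < c * (Gamma a * x powr - a)"
    using x0 by (simp add: powr_minus_divide field_simps)
  then have "0 < (LINT u|lborel. ?g u)" unfolding val by simp
  also have "\<dots> \<le> (LINT u|lborel. ray_weight a 1 x u * cos (ray_angle a 1 u) - ray_weight 1 a x u)"
  proof (rule integral_mono[OF int Bochner_Integration.integrable_diff[OF integrable_ray_trig(1) integrable_ray']])
    fix u :: real
    have "(1 + u\<^sup>2) powr ((a - 1) / 2) \<le> 1"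
      using a23 by (intro one_add_square_powr_le_1) auto
    then have "ray_weight 1 a x u \<le> gamma_weight 1 x u"
      by (simp add: ray_weight_def gamma_weight_def)
    moreover have "ray_weight a 1 x u * cos (ray_angle a 1 u) = c * gamma_weight a x u"
      by (auto simp: ray_weight_def gamma_weight_def ray_angle_def c_def add_nonneg_eq_0_iff)
    ultimately show "?g u \<le> ray_weight a 1 x u * cos (ray_angle a 1 u) - ray_weight 1 a x u" by linarith
  qed
  also have "\<dots> \<le> Re (beta_fourier a 1 x)" by (rule Re_beta_fourier_ge)
  finally show ?thesis .
qed

text \<open>In the middle range, x^a U has derivative x^(a-1) cos x \<le> 0 up to 3 pi/2, so it is
  bounded below by its value there, which the ray estimate shows to be positive.\<close>

lemma Re_beta_fourier_pos_b_1:
  assumes a: "0 < a" "a \<le> 2/3" and x: "x > 0"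
  shows "0 < Re (beta_fourier a 1 x)"
proof -
  consider "x \<le> pi/2" | "pi/2 \<le> x" "x \<le> 3/2 * pi" | "x \<ge> 3/2 * pi" by linarith
  then show ?thesis
  proof cases
    case 1
    then show ?thesis using a x by (intro Re_beta_fourier_pos_le_half_pi) auto
  next
    case 2
    define G where "G y = y powr a * Re (beta_fourier a 1 y)" for y
    have "G (3/2 * pi) \<le> G x"
    proof (rule DERIV_nonpos_imp_nonincreasing[OF 2(2)])
      fix y assume y: "x \<le> y" "y \<le> 3/2 * pi"
      then have y0: "y > 0" using x by simp
      have dF: "((\<lambda>y. Re (beta_fourier a 1 y)) has_real_derivative Re (\<i> * beta_fourier (a + 1) 1 y)) (at y)"
        using bounded_linear.has_vector_derivative[OF bounded_linear_Re has_vector_derivative_beta_fourier[of a 1 y]] a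
        by (simp add: has_real_derivative_iff_has_vector_derivative)
      have "(G has_real_derivative (a * y powr (a - 1)) * Re (beta_fourier a 1 y) + Re (\<i> * beta_fourier (a + 1) 1 y) * y powr a) (at y)"
        unfolding G_def by (rule DERIV_mult[OF has_real_derivative_powr[OF y0] dF])
      also have "y powr a = y powr (a - 1) * y" using y0 powr_mult_base[of y "a - 1"] by (simp add: mult.commute)
      also have "(a * y powr (a - 1)) * Re (beta_fourier a 1 y) + Re (\<i> * beta_fourier (a + 1) 1 y) * (y powr (a - 1) * y) =
          y powr (a - 1) * Re (of_real a * beta_fourier a 1 y + \<i> * of_real y * beta_fourier (a + 1) 1 y)"
        by (simp add: algebra_simps)
      also have "\<dots> = y powr (a - 1) * cos y"
        unfolding beta_fourier_one_ode[OF a(1)] by simp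
      finally have d: "(G has_real_derivative y powr (a - 1) * cos y) (at y)" .
      have "0 \<le> cos (y - pi)" using y 2 by (intro cos_ge_zero) auto
      then have "cos y \<le> 0" by (simp add: cos_diff)
      then show "\<exists>d. (G has_real_derivative d) (at y) \<and> d \<le> 0"
        using d by (intro exI[of _ "y powr (a - 1) * cos y"]) (auto intro: mult_nonneg_nonpos)
    qed
    moreover have "G (3/2 * pi) > 0" unfolding G_def
      using Re_beta_fourier_pos_b_1_large[OF a, of "3/2 * pi"] by simp
    ultimately have "G x > 0" by linarith
    then show ?thesis using x by (simp add: G_def zero_less_mult_iff)
  next
    case 3
    then show ?thesis using Re_beta_fourier_pos_b_1_large[OF a] by simp
  qed
qed

section \<open>Positivity on the regions\<close>

lemma Im_beta_fourier_base:
  assumes a: "0 < a" "a \<le> 2" and b: "b = max ((a + 1) / 2) (2 * a - 1)" and x: "x > 0"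
  shows "0 \<le> Im (beta_fourier a b x)" and "a \<noteq> 1 \<Longrightarrow> 0 < Im (beta_fourier a b x)"
proof -
  have b0: "b > 0" using a b by (simp add: less_max_iff_disj)
  have strict: "0 < Im (beta_fourier a b x)" if "a \<noteq> 1"
  proof (cases "x \<le> pi")
    case True
    then show ?thesis using a b0 x by (intro Im_beta_fourier_pos_le_pi) auto
  next
    case False
    consider "a < 1" | "a > 1" using \<open>a \<noteq> 1\<close> by linarith
    then show ?thesis
    proof cases
      case 1
      have "0 < Im (beta_fourier (1 - 2 * ((1 - a) / 2)) (1 - (1 - a) / 2) x)"
        by (rule Im_beta_fourier_pos_a_lt_1) (use 1 a False in auto)
      moreover have "1 - 2 * ((1 - a) / 2) = a" "1 - (1 - a) / 2 = b"
        using 1 b by (simp_all add: max_def field_simps)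
      ultimately show ?thesis by (simp only:)
    next
      case 2
      have "0 < Im (beta_fourier (1 + (a - 1)) (1 + 2 * (a - 1)) x)"
        by (rule Im_beta_fourier_pos_a_gt_1) (use 2 a False in auto)
      moreover have "1 + (a - 1) = a" "1 + 2 * (a - 1) = b"
        using 2 b by (simp_all add: max_def field_simps)
      ultimately show ?thesis by (simp only:)
    qed
  qed
  then show "a \<noteq> 1 \<Longrightarrow> 0 < Im (beta_fourier a b x)" .
  show "0 \<le> Im (beta_fourier a b x)"
  proof (cases "a = 1")
    case True
    then have b1: "b = 1" using b by simp
    interpret beta_contour 1 1 x using x by unfold_locales auto
    \<comment> \<open>At the corner (1,1) the two ray integrands coincide, and only the weak
      inequality survives.\<close>
    have "ray_weight 1 1 x u * sin (ray_angle 1 1 u) - ray_weight 1 1 x u = 0" for u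
      by (simp add: ray_angle_def)
    then have "(LINT u|lborel. ray_weight 1 1 x u * sin (ray_angle 1 1 u) - ray_weight 1 1 x u) = 0"
      by (simp only: Bochner_Integration.integral_zero)
    then show ?thesis using Im_beta_fourier_ge True b1 by (simp only:)
  next
    case False
    then show ?thesis using strict by simp
  qed
qed

lemma P_s_Im_pos:
  assumes P: "(\<alpha>, \<beta>) \<in> P_s" and x: "x > 0"
  shows "0 < Im (beta_fourier \<alpha> \<beta> x)"
proof -
  define b where "b = max ((\<alpha> + 1) / 2) (2 * \<alpha> - 1)"
  have a: "0 < \<alpha>" "\<alpha> \<le> 2" and "b \<le> \<beta>" and ne: "(\<alpha>, \<beta>) \<noteq> (1, 1)"
    using P by (auto simp: P_s_def b_def)
  have b0: "b > 0" using a by (simp add: b_def less_max_iff_disj)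
  show ?thesis
  proof (cases "\<beta> = b")
    case True
    then have "\<alpha> \<noteq> 1" using ne by (auto simp: b_def)
    then show ?thesis using Im_beta_fourier_base(2)[OF a b_def x] True by simp
  next
    case False
    then have "b < \<beta>" using \<open>b \<le> \<beta>\<close> by simp
    then show ?thesis
    proof (rule fractional_integral_pos[OF bounded_linear_Im a(1) b0 _ x])
      show "0 \<le> Im (beta_fourier \<alpha> b y)" if "y > 0" for y
        by (rule Im_beta_fourier_base(1)[OF a b_def that])
      show "0 < Im (beta_fourier \<alpha> b y)" if "y > 0" "y < pi" for y
        using that a b0 by (intro Im_beta_fourier_pos_le_pi) auto
    qed simp
  qed
qed

text \<open>The two pieces of \<open>P_c\<close> merge: for \<alpha> \<le> 2/3 they amount to
  \<beta> \<ge> 1, beyond that to \<beta> \<ge> \<alpha> + 1. These lower bounds are the starting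
  points of the fractional integration.\<close>

lemma P_c_Re_pos:
  assumes P: "(\<alpha>, \<beta>) \<in> P_c" and x: "x > 0"
  shows "0 < Re (beta_fourier \<alpha> \<beta> x)"
proof -
  have frac: "0 < Re (beta_fourier \<alpha> \<beta> x)"
    if "0 < \<alpha>" "0 < b" "b < \<beta>" "\<And>y. y > 0 \<Longrightarrow> 0 \<le> Re (beta_fourier \<alpha> b y)" for b
  proof (rule fractional_integral_pos[OF bounded_linear_Re that(1-3) x that(4)])
    show "0 < Re (beta_fourier \<alpha> b y)" if "0 < y" "y < pi/2" for y
      using that \<open>0 < \<alpha>\<close> \<open>0 < b\<close> by (intro Re_beta_fourier_pos_le_half_pi) auto
  qed auto
  have "0 < \<alpha>" "\<alpha> \<le> 1" using P by (auto simp: P_c_def)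
  show ?thesis
  proof (cases "\<alpha> \<le> 2/3")
    case True
    then have "\<beta> \<ge> 1" using P by (auto simp: P_c_def)
    then show ?thesis
      using frac[of 1] Re_beta_fourier_pos_b_1[OF \<open>0 < \<alpha>\<close> True] x \<open>0 < \<alpha>\<close>
      by (cases "\<beta> = 1") (auto intro: less_imp_le)
  next
    case False
    then have b: "\<beta> \<ge> \<alpha> + 1" and ne: "(\<alpha>, \<beta>) \<noteq> (1, 2)" using P by (auto simp: P_c_def)
    show ?thesis
    proof (cases "\<beta> = \<alpha> + 1")
      case True
      then have "\<alpha> < 1" using ne \<open>\<alpha> \<le> 1\<close> by (auto simp: less_le)
      then show ?thesis using Re_beta_fourier_a_plus_1(2)[OF \<open>0 < \<alpha>\<close> \<open>\<alpha> \<le> 1\<close> x] True by simp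
    next
      case False
      then show ?thesis
        using b frac[of "\<alpha> + 1"] Re_beta_fourier_a_plus_1(1)[OF \<open>0 < \<alpha>\<close> \<open>\<alpha> \<le> 1\<close>] \<open>0 < \<alpha>\<close> by simp
    qed
  qed
qed

lemma P_c_subset_P_s: "P_c \<subset> P_s"
proof
  show "P_c \<subseteq> P_s" by (auto simp: P_c_def P_s_def)
  have "(2, 3) \<in> P_s" "(2, 3) \<notin> P_c" by (auto simp: P_s_def P_c_def)
  then show "P_c \<noteq> P_s" by blast
qed

section \<open>Transfer to the given functions\<close>

text \<open>(\<alpha> + 1)/2 is at least \<alpha> up to \<alpha> = 1, and 2 \<alpha> - 1 is at least
  \<alpha> from there on. The resulting order of the parameters is the hypothesis of the Wronskian
  bound.\<close>

lemma P_s_bounds: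
  assumes "(\<alpha>, \<beta>) \<in> P_s"
  shows "0 < \<alpha>" "0 < \<beta>" "\<alpha> \<le> \<beta>"
  using assms by (auto simp: P_s_def)

lemma phase_pair_P_s:
  assumes P: "(\<alpha>, \<beta>) \<in> P_s"
  defines "B \<equiv> Beta \<alpha> \<beta>"
  shows "phase_pair (Phi \<alpha> \<beta>) (Psi \<alpha> \<beta>)
    (\<lambda>x. - Im (beta_fourier (\<beta> + 1) \<alpha> x) / B) (\<lambda>x. Re (beta_fourier (\<beta> + 1) \<alpha> x) / B)
    (\<lambda>x. Re (beta_fourier \<alpha> \<beta> x) / B) (\<lambda>x. Im (beta_fourier \<alpha> \<beta> x) / B)"
proof -
  note b = P_s_bounds[OF P]
  have B: "B > 0" unfolding B_def using b by (intro Beta_real_pos)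
  define F K where "F = beta_fourier \<beta> \<alpha>" and "K = beta_fourier (\<beta> + 1) \<alpha>"
  have eq: "Phi \<alpha> \<beta> = (\<lambda>x. Re (F x) / B)" "Psi \<alpha> \<beta> = (\<lambda>x. Im (F x) / B)"
    using Phi_Psi_eq[OF b(1,2)] by (auto simp: F_def B_def)
  have r: "F x = cis x * cnj (beta_fourier \<alpha> \<beta> x)" for x
    unfolding F_def by (rule beta_fourier_reflect[OF b(1,2)])
  have dF: "(F has_vector_derivative \<i> * K x) (at x)" for x
    unfolding F_def K_def using b by (intro has_vector_derivative_beta_fourier)
  have dRe: "((\<lambda>x. Re (F x)) has_real_derivative - Im (K x)) (at x)"
    and dIm: "((\<lambda>x. Im (F x)) has_real_derivative Re (K x)) (at x)" for x
    using bounded_linear.has_vector_derivative[OF bounded_linear_Re dF[of x]]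
      bounded_linear.has_vector_derivative[OF bounded_linear_Im dF[of x]]
    by (simp_all add: has_real_derivative_iff_has_vector_derivative)
  show ?thesis
  proof
    fix x :: real
    show "(Phi \<alpha> \<beta> has_real_derivative - Im (beta_fourier (\<beta> + 1) \<alpha> x) / B) (at x)"
      unfolding eq K_def[symmetric] by (rule DERIV_cdivide[OF dRe])
    show "(Psi \<alpha> \<beta> has_real_derivative Re (beta_fourier (\<beta> + 1) \<alpha> x) / B) (at x)"
      unfolding eq K_def[symmetric] by (rule DERIV_cdivide[OF dIm])
    show "Phi \<alpha> \<beta> x = cos x * (Re (beta_fourier \<alpha> \<beta> x) / B) + sin x * (Im (beta_fourier \<alpha> \<beta> x) / B)"
      "Psi \<alpha> \<beta> x = sin x * (Re (beta_fourier \<alpha> \<beta> x) / B) - cos x * (Im (beta_fourier \<alpha> \<beta> x) / B)"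
      unfolding eq r by (simp_all add: add_divide_distrib diff_divide_distrib)
    assume x: "x > 0"
    show V: "Im (beta_fourier \<alpha> \<beta> x) / B > 0" using P_s_Im_pos[OF P x] B by simp
    show "0 < Phi \<alpha> \<beta> x * (Re (beta_fourier (\<beta> + 1) \<alpha> x) / B) - Psi \<alpha> \<beta> x * (- Im (beta_fourier (\<beta> + 1) \<alpha> x) / B)"
    proof -
      \<comment> \<open>V > 0 excludes a zero of F, and this makes the weak Wronskian bound
        strict.\<close>
      have "F x \<noteq> 0" unfolding r using V by auto
      then have "0 < (norm (F x))\<^sup>2 / 2" by simp
      also have "\<dots> \<le> Re (cnj (F x) * K x)"
        unfolding F_def K_def using b x by (intro wronskian_lower_bound) auto
      finally have "0 < Re (cnj (F x) * K x) / (B * B)" using B by simp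
      then show ?thesis unfolding eq K_def by (simp add: add_divide_distrib)
    qed
  next
    fix x assume "0 < x" "x \<le> pi / 2"
    then show "Phi \<alpha> \<beta> x > 0"
      unfolding eq F_def using b B by (simp add: Re_beta_fourier_pos_le_half_pi)
  next
    fix x assume "0 < x" "x \<le> pi"
    then show "Psi \<alpha> \<beta> x > 0"
      unfolding eq F_def using b B by (simp add: Im_beta_fourier_pos_le_pi)
  qed
qed

theorem theorem8p2:
  shows "P_c \<subset> P_s \<and>
    (\<forall>\<alpha> \<beta>. (\<alpha>, \<beta>) \<in> P_c \<longrightarrow>
      (\<forall>k::nat. k \<ge> 1 \<longrightarrow>
         one_zero_simple (Phi \<alpha> \<beta>) {(real k - 1/2) * pi <..< real k * pi} \<and>
         one_zero_simple (Psi \<alpha> \<beta>) {real k * pi <..< (real k + 1/2) * pi}) \<and>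
      (\<forall>x>0. Phi \<alpha> \<beta> x = 0 \<longrightarrow> (\<exists>k::nat. k \<ge> 1 \<and> x \<in> {(real k - 1/2) * pi <..< real k * pi})) \<and>
      (\<forall>x>0. Psi \<alpha> \<beta> x = 0 \<longrightarrow> (\<exists>k::nat. k \<ge> 1 \<and> x \<in> {real k * pi <..< (real k + 1/2) * pi})) \<and>
      \<not> (\<exists>x>0. Phi \<alpha> \<beta> x = 0 \<and> Psi \<alpha> \<beta> x = 0)) \<and>
    (\<forall>\<alpha> \<beta>. (\<alpha>, \<beta>) \<in> P_s - P_c \<longrightarrow>
      (\<forall>k::nat. k \<ge> 1 \<longrightarrow>
         one_zero_simple (Phi \<alpha> \<beta>) {(real k - 1/2) * pi <..< (real k + 1/2) * pi} \<and>
         one_zero_simple (Psi \<alpha> \<beta>) {real k * pi <..< (real k + 1) * pi}) \<and>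
      (\<forall>x>0. Phi \<alpha> \<beta> x = 0 \<longrightarrow> (\<exists>k::nat. k \<ge> 1 \<and> x \<in> {(real k - 1/2) * pi <..< (real k + 1/2) * pi})) \<and>
      (\<forall>x>0. Psi \<alpha> \<beta> x = 0 \<longrightarrow> (\<exists>k::nat. k \<ge> 1 \<and> x \<in> {real k * pi <..< (real k + 1) * pi})) \<and>
      \<not> (\<exists>x>0. Phi \<alpha> \<beta> x = 0 \<and> Psi \<alpha> \<beta> x = 0))"
proof (intro conjI)
  show "P_c \<subset> P_s" by (rule P_c_subset_P_s)
next
  show "\<forall>\<alpha> \<beta>. (\<alpha>, \<beta>) \<in> P_c \<longrightarrow>
      (\<forall>k::nat. k \<ge> 1 \<longrightarrow>
         one_zero_simple (Phi \<alpha> \<beta>) {(real k - 1/2) * pi <..< real k * pi} \<and>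
         one_zero_simple (Psi \<alpha> \<beta>) {real k * pi <..< (real k + 1/2) * pi}) \<and>
      (\<forall>x>0. Phi \<alpha> \<beta> x = 0 \<longrightarrow> (\<exists>k::nat. k \<ge> 1 \<and> x \<in> {(real k - 1/2) * pi <..< real k * pi})) \<and>
      (\<forall>x>0. Psi \<alpha> \<beta> x = 0 \<longrightarrow> (\<exists>k::nat. k \<ge> 1 \<and> x \<in> {real k * pi <..< (real k + 1/2) * pi})) \<and>
      \<not> (\<exists>x>0. Phi \<alpha> \<beta> x = 0 \<and> Psi \<alpha> \<beta> x = 0)"
  proof (intro allI impI)
    fix \<alpha> \<beta> assume P: "(\<alpha>, \<beta>) \<in> P_c"
    then have Ps: "(\<alpha>, \<beta>) \<in> P_s" using P_c_subset_P_s by auto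
    interpret phase_pair "Phi \<alpha> \<beta>" "Psi \<alpha> \<beta>"
      "\<lambda>x. - Im (beta_fourier (\<beta> + 1) \<alpha> x) / Beta \<alpha> \<beta>" "\<lambda>x. Re (beta_fourier (\<beta> + 1) \<alpha> x) / Beta \<alpha> \<beta>"
      "\<lambda>x. Re (beta_fourier \<alpha> \<beta> x) / Beta \<alpha> \<beta>" "\<lambda>x. Im (beta_fourier \<alpha> \<beta> x) / Beta \<alpha> \<beta>"
      by (rule phase_pair_P_s[OF Ps])
    have U: "0 < Re (beta_fourier \<alpha> \<beta> x) / Beta \<alpha> \<beta>" if "x > 0" for x
      using P_c_Re_pos[OF P that] Beta_real_pos[OF P_s_bounds(1,2)[OF Ps]] by simp
    show "(\<forall>k::nat. k \<ge> 1 \<longrightarrow>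
         one_zero_simple (Phi \<alpha> \<beta>) {(real k - 1/2) * pi <..< real k * pi} \<and>
         one_zero_simple (Psi \<alpha> \<beta>) {real k * pi <..< (real k + 1/2) * pi}) \<and>
      (\<forall>x>0. Phi \<alpha> \<beta> x = 0 \<longrightarrow> (\<exists>k::nat. k \<ge> 1 \<and> x \<in> {(real k - 1/2) * pi <..< real k * pi})) \<and>
      (\<forall>x>0. Psi \<alpha> \<beta> x = 0 \<longrightarrow> (\<exists>k::nat. k \<ge> 1 \<and> x \<in> {real k * pi <..< (real k + 1/2) * pi})) \<and>
      \<not> (\<exists>x>0. Phi \<alpha> \<beta> x = 0 \<and> Psi \<alpha> \<beta> x = 0)"
      using one_zero_P_left_half[OF U] one_zero_Q_left_half[OF U]
        P_zero_location_left_half[OF U] Q_zero_location_left_half[OF U] no_common_zero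
      by (intro conjI allI impI notI) blast+
  qed
next
  show "\<forall>\<alpha> \<beta>. (\<alpha>, \<beta>) \<in> P_s - P_c \<longrightarrow>
      (\<forall>k::nat. k \<ge> 1 \<longrightarrow>
         one_zero_simple (Phi \<alpha> \<beta>) {(real k - 1/2) * pi <..< (real k + 1/2) * pi} \<and>
         one_zero_simple (Psi \<alpha> \<beta>) {real k * pi <..< (real k + 1) * pi}) \<and>
      (\<forall>x>0. Phi \<alpha> \<beta> x = 0 \<longrightarrow> (\<exists>k::nat. k \<ge> 1 \<and> x \<in> {(real k - 1/2) * pi <..< (real k + 1/2) * pi})) \<and>
      (\<forall>x>0. Psi \<alpha> \<beta> x = 0 \<longrightarrow> (\<exists>k::nat. k \<ge> 1 \<and> x \<in> {real k * pi <..< (real k + 1) * pi})) \<and>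
      \<not> (\<exists>x>0. Phi \<alpha> \<beta> x = 0 \<and> Psi \<alpha> \<beta> x = 0)"
  proof (intro allI impI)
    fix \<alpha> \<beta> assume "(\<alpha>, \<beta>) \<in> P_s - P_c"
    then have Ps: "(\<alpha>, \<beta>) \<in> P_s" by simp
    interpret phase_pair "Phi \<alpha> \<beta>" "Psi \<alpha> \<beta>"
      "\<lambda>x. - Im (beta_fourier (\<beta> + 1) \<alpha> x) / Beta \<alpha> \<beta>" "\<lambda>x. Re (beta_fourier (\<beta> + 1) \<alpha> x) / Beta \<alpha> \<beta>"
      "\<lambda>x. Re (beta_fourier \<alpha> \<beta> x) / Beta \<alpha> \<beta>" "\<lambda>x. Im (beta_fourier \<alpha> \<beta> x) / Beta \<alpha> \<beta>"
      by (rule phase_pair_P_s[OF Ps])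
    show "(\<forall>k::nat. k \<ge> 1 \<longrightarrow>
         one_zero_simple (Phi \<alpha> \<beta>) {(real k - 1/2) * pi <..< (real k + 1/2) * pi} \<and>
         one_zero_simple (Psi \<alpha> \<beta>) {real k * pi <..< (real k + 1) * pi}) \<and>
      (\<forall>x>0. Phi \<alpha> \<beta> x = 0 \<longrightarrow> (\<exists>k::nat. k \<ge> 1 \<and> x \<in> {(real k - 1/2) * pi <..< (real k + 1/2) * pi})) \<and>
      (\<forall>x>0. Psi \<alpha> \<beta> x = 0 \<longrightarrow> (\<exists>k::nat. k \<ge> 1 \<and> x \<in> {real k * pi <..< (real k + 1) * pi})) \<and>
      \<not> (\<exists>x>0. Phi \<alpha> \<beta> x = 0 \<and> Psi \<alpha> \<beta> x = 0)"
      using one_zero_P one_zero_Q P_zero_location Q_zero_location no_common_zero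
      by (intro conjI allI impI notI) blast+
  qed
qed

end
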